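(* Let $B$ be a loop braid on $s$ strands, represented by a word of length $\ell$, and let $f:\mathbb{R}^5\to\mathbb{R}^2$ be the corresponding polynomial found by Algorithm 1 (the interpolation algorithm described in the context). For each component $C$ of the closure of $B$ denote the number of strands in $C$ by $s_C$. Then $$\deg f\leq 2\sum_C\max\left\{\left\lfloor\frac{(s_C+1)(s_C\ell-1)+\ell s_C(s-s_C)-1}{2}\right\rfloor,s_C\right\},$$ where the sum is over the components $C$ of the closure of $B$.
   Context: **Loop braids.** The loop braid group $LB_s$ is the fundamental group of the configuration space of $s$ disjoint unordered unlinked Euclidean circles in the 3-ball, each lying in a plane parallel to a fixed plane, here the $xy$-plane of $\mathbb{R}^3$. A loop braid is an element of $LB_s$, represented by a motion of circles parametrised by $t\in[0,2\pi]$; the trace of one circle in $\mathbb{R}^3\times[0,2\pi]$ is a strand. Words are in the generators $\sigma_i,\rho_i$ ($i=1,\dots,s-1$) and their inverses. Starting from circles in a row in the $xy$-plane, $\rho_i$ exchanges the $i$th and $(i+1)$st circle by moving them around each other within the $xy$-plane; $\sigma_i$ exchanges them by shrinking the $i$th circle and passing it from above (decreasing $z$) through the hole of the $(i+1)$st, then restoring position in the plane and radius. The closure of $B$ identifies the circles at $t=0$ with those at $t=2\pi$, giving tori in $\mathbb{R}^3\times S^1\subset\mathbb{R}^4\subset S^4$; these are the components $C$. The strands of $C$ are labelled $(C,j)$, $j=1,\dots,s_C$ (mod $s_C$), so that $(C,j)$ ends where $(C,j+1)$ starts. **Algorithm 1.** Draw the centre lines of the circles as a diagram in the $xt$-plane,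 with one crossing per letter, the $k$th in $[2\pi k/\ell,2\pi(k+1)/\ell]$, $k=0,\dots,\ell-1$. A letter $\rho_i^{\pm1}$ gives a classical over/under crossing (a $\rho$-crossing), and $\sigma_i^{\pm1}$ gives an intersection point of the two centre lines labelled with the sign $\pm$ (a $\sigma$-crossing). The steps are: 1. For each $C$ find a trigonometric polynomial $F_C$ by trigonometric interpolation of the $s_C\ell$ data points $\left(\frac{2\pi k/\ell+2\pi(j-1)}{s_C},L_{C,j}(2\pi k/\ell)\right)$, where $L_{C,j}(2\pi k/\ell)$ is the $x$-position of $(C,j)$ in the diagram at $t=2\pi k/\ell$ (the positions before and after every crossing). 2. The graphs of $t\mapsto F_C\left(\frac{t+2\pi(j-1)}{s_C}\right)$ form a diagram $B'$ without crossing signs. For each $k$ assign to the strands pairwise distinct reals $y_{C,j,k}$ such that, if the $k$th crossing of $B$ is a $\rho$-crossing, its overpassing strand gets a larger value than its underpassing strand; if it is a $\sigma$-crossing, no other assigned value lies between those of its two strands. For each crossing of $B'$ at $t=t_*$ in the $k$th interval, each strand $(C,j)$ involved contributes a data point $\left(\frac{t_*+2\pi(j-1)}{s_C},y_{C,j,k}\right)$ for $C$. The exception: if the $k$th crossing of $B$ is a $\sigma$-crossing, then at the first crossing of $B'$ in that interval between the same two strands, both strands get one common value lying between their two assigned values. Trigonometric interpolation gives $G_C$. 3. Find trigonometric polynomials $H_C$ by trigonometric interpolation with prescribed values and first derivatives at the parameters $\frac{t+2\pi(j-1)}{s_C}$ of the $\sigma$-crossings in which strands $(C,j)$ are involved: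 at each $\sigma$-crossing the two strands get equal values, and the strand coming from above gets the smaller derivative. 4. Find trigonometric polynomials $R_C$ by trigonometric interpolation with prescribed values at the same parameters, such that at each $\sigma$-crossing the circle passing through the hole of the other has the smaller value. Add one common sufficiently large constant to all $R_C$ to make them positive, then multiply all by one common sufficiently small positive constant so that no circles intersect. 5. Put $(x_{C,j},y_{C,j},z_{C,j},\varrho_{C,j})(t)=(F_C,G_C,H_C,R_C)\left(\frac{t+2\pi(j-1)}{s_C}\right)$, $P_{C,j}(x,y,z,t)=(x-x_{C,j}(t))^2+(y-y_{C,j}(t))^2-\varrho_{C,j}(t)^2+\mathrm{i}(z-z_{C,j}(t))$, and, for $\lambda>0$, $g_\lambda(x,y,z,t)=\prod_C\prod_{j=1}^{s_C}P_{C,j}\left(\frac{x}{\lambda},\frac{y}{\lambda},\frac{z}{\lambda},t\right)$. Expanded, $g_\lambda$ is a polynomial in $x,y,z,e^{\mathrm{i}t},e^{-\mathrm{i}t}$; replacing $e^{\mathrm{i}t}$ by a complex variable $v$ and $e^{-\mathrm{i}t}$ by $\overline{v}$ gives a polynomial $f_\lambda:\mathbb{R}^5\cong\mathbb{R}^3\times\mathbb{C}\to\mathbb{C}\cong\mathbb{R}^2$. 6. Choose $\lambda>0$ small enough that the vanishing set $f_\lambda^{-1}(0)\cap S^4$ on the unit 4-sphere contains a set ambient isotopic to the closure of $B$; the output is $f=f_\lambda$. Here $\deg f$ is the degree of $f$ as a real polynomial map. *)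

theory Defs
  imports "HOL-Analysis.Analysis" "HOL-Combinatorics.Orbits"
begin

section \<open>Loop braids\<close>

text \<open>A circle parallel to the \<open>xy\<close>-plane is given by its centre and its radius.\<close>

type_synonym circle = "(real^3) \<times> real"

definition circle_set :: "circle \<Rightarrow> (real^3) set" where
  "circle_set c =
     {p. (p$1 - fst c$1)^2 + (p$2 - fst c$2)^2 = (snd c)^2 \<and> p$3 = fst c$3}"

text \<open>
  Ordered configurations of \<open>s\<close> disjoint circles in a 3-ball, indexed by \<open>1, \<dots>, s\<close>. Disjoint
  circles in parallel planes are automatically unlinked.
\<close>

definition configuration :: "nat \<Rightarrow> (nat \<Rightarrow> circle) \<Rightarrow> bool" where
  "configuration s c \<longleftrightarrow>
     (\<forall>i\<in>{1..s}. snd (c i) > 0 \<and> circle_set (c i) \<subseteq> ball 0 (real s + 1)) \<and>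
     (\<forall>i\<in>{1..s}. \<forall>j\<in>{1..s}. i \<noteq> j \<longrightarrow> circle_set (c i) \<inter> circle_set (c j) = {})"

definition base_circle :: "nat \<Rightarrow> circle" where
  "base_circle i = (vector [real i, 0, 0], 1/4)"

text \<open>
  A loop in the space of unordered configurations based at the circles in a row is the same as a
  path of ordered configurations (its unique lift) that starts at the row and returns to it up to
  a permutation. The element at index \<open>i\<close> is the circle starting in the \<open>i\<close>th place.
\<close>

type_synonym motion = "real \<Rightarrow> nat \<Rightarrow> circle"

definition loop_motion :: "nat \<Rightarrow> motion \<Rightarrow> bool" where
  "loop_motion s \<beta> \<longleftrightarrow>
     (\<forall>i\<in>{1..s}. continuous_on {0..2*pi} (\<lambda>t. \<beta> t i)) \<and>
     (\<forall>t\<in>{0..2*pi}. configuration s (\<beta> t)) \<and>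
     (\<forall>i\<in>{1..s}. \<beta> 0 i = base_circle i) \<and>
     \<beta> (2*pi) ` {1..s} = base_circle ` {1..s}"

definition motion_homotopic :: "nat \<Rightarrow> (motion \<times> motion) set" where
  "motion_homotopic s = {(\<beta>, \<gamma>). loop_motion s \<beta> \<and> loop_motion s \<gamma> \<and>
     (\<exists>H :: real \<Rightarrow> motion.
        (\<forall>i\<in>{1..s}. continuous_on ({0..1} \<times> {0..2*pi}) (\<lambda>(u, t). H u t i)) \<and>
        (\<forall>u\<in>{0..1}. loop_motion s (H u)) \<and>
        (\<forall>t\<in>{0..2*pi}. \<forall>i\<in>{1..s}. H 0 t i = \<beta> t i \<and> H 1 t i = \<gamma> t i))}"

text \<open>The underlying set of the loop braid group \<open>LB\<^sub>s\<close>.\<close>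

definition loop_braids :: "nat \<Rightarrow> motion set set" where
  "loop_braids s = {\<beta>. loop_motion s \<beta>} // motion_homotopic s"

subsection \<open>Words and the motions they describe\<close>

text \<open>\<open>Sig i True\<close>, \<open>Sig i False\<close>, \<open>Rho i True\<close>, \<open>Rho i False\<close> stand for
  \<open>\<sigma>\<^sub>i\<close>, its inverse, \<open>\<rho>\<^sub>i\<close>, its inverse.\<close>

datatype letter =
    is_sigma: Sig (idx: nat) (positive: bool)
  | Rho (idx: nat) (positive: bool)

definition letters :: "nat \<Rightarrow> letter set" where
  "letters s = {a. 1 \<le> idx a \<and> idx a < s}"

definition letter_swap :: "letter \<Rightarrow> nat \<Rightarrow> nat" where
  "letter_swap a = Transposition.transpose (idx a) (Suc (idx a))"

text \<open>The motion, over \<open>\<tau> \<in> [0,1]\<close>, of the circle that starts at place \<open>q\<close>. In \<open>\<sigma>\<^sub>i\<close> the shrunk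
  \<open>i\<close>th circle meets the plane of the \<open>(i+1)\<close>st at \<open>\<tau> = 1/2\<close>, moving downwards; in \<open>\<rho>\<^sub>i\<close> the
  \<open>i\<close>th circle passes on the side of larger \<open>y\<close>.\<close>

fun generator_motion :: "letter \<Rightarrow> real \<Rightarrow> nat \<Rightarrow> circle" where
  "generator_motion (Sig i _) \<tau> q =
     (if q = i then (vector [real i + \<tau>, 0, sin (2*pi*\<tau>) / 4], 1/4 - sin (pi*\<tau>) / 8)
      else if q = Suc i then (vector [real i + 1 - \<tau>, 0, 0], 1/4)
      else base_circle q)"
| "generator_motion (Rho i _) \<tau> q =
     (if q = i then (vector [real i + 1/2 - cos (pi*\<tau>) / 2, sin (pi*\<tau>) / 2, 0], 1/4)
      else if q = Suc i then (vector [real i + 1/2 + cos (pi*\<tau>) / 2, - sin (pi*\<tau>) / 2, 0], 1/4)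
      else base_circle q)"

definition letter_motion :: "letter \<Rightarrow> real \<Rightarrow> nat \<Rightarrow> circle" where
  "letter_motion a \<tau> q =
     (if positive a then generator_motion a \<tau> q
      else generator_motion a (1 - \<tau>) (letter_swap a q))"

text \<open>The place, after the first \<open>k\<close> letters, of the circle starting at place \<open>p\<close>.\<close>

definition word_pos :: "letter list \<Rightarrow> nat \<Rightarrow> nat \<Rightarrow> nat" where
  "word_pos w k = fold letter_swap (take k w)"

definition word_motion :: "letter list \<Rightarrow> motion" where
  "word_motion w t p =
     (if w = [] then base_circle p
      else let l = length w;
               k = min (l - 1) (nat \<lfloor>t * real l / (2*pi)\<rfloor>)
           in letter_motion (w ! k) (t * real l / (2*pi) - real k) (word_pos w k p))"

subsection \<open>The closure and its components\<close>

text \<open>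
  The closure in \<open>S\<^sup>4\<close>, the unit sphere of \<open>\<real>\<^sup>3 \<times> \<complex>\<close>. The space \<open>\<real>\<^sup>3 \<times> S\<^sup>1\<close> is identified with the
  complement of the 2-sphere \<open>v = 0\<close> in \<open>S\<^sup>4\<close> by radial projection; the point \<open>e\<^sup>i\<^sup>t\<close> of \<open>S\<^sup>1\<close>
  becomes the argument of the complex coordinate.
\<close>

definition braid_closure :: "nat \<Rightarrow> motion \<Rightarrow> ((real^3) \<times> complex) set" where
  "braid_closure s \<beta> =
     {(1 / sqrt (1 + (norm p)^2)) *\<^sub>R (p, cis t) | p t.
        t \<in> {0..2*pi} \<and> (\<exists>i\<in>{1..s}. p \<in> circle_set (\<beta> t i))}"

definition ambient_isotopic :: "'a::topological_space set \<Rightarrow> 'a set \<Rightarrow> 'a set \<Rightarrow> bool" where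
  "ambient_isotopic M A B \<longleftrightarrow> A \<subseteq> M \<and> B \<subseteq> M \<and>
     (\<exists>\<Phi> :: real \<Rightarrow> 'a \<Rightarrow> 'a.
        continuous_on ({0..1} \<times> M) (\<lambda>(u, x). \<Phi> u x) \<and>
        (\<forall>u\<in>{0..1}. \<exists>\<Psi>. homeomorphism M M (\<Phi> u) \<Psi>) \<and>
        (\<forall>x\<in>M. \<Phi> 0 x = x) \<and> \<Phi> 1 ` A = B)"

text \<open>
  The closure glues the end of the strand starting at \<open>p\<close> to the start of the strand starting at
  \<open>word_pos w (length w) p\<close>. A component is represented by the set \<open>C\<close> of the starting places of
  its strands, so that \<open>s\<^sub>C = card C\<close>.
\<close>

definition closure_components :: "nat \<Rightarrow> letter list \<Rightarrow> nat set set" where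
  "closure_components s w = orbit (word_pos w (length w)) ` {1..s}"

text \<open>
  Strands are pairs \<open>(C, j)\<close> with \<open>j\<close> counted from \<open>0\<close>, i.e. \<open>j\<close> plays the role of \<open>j - 1\<close> in the
  usual labelling \<open>1, \<dots>, s\<^sub>C\<close>. The function \<open>b\<close> picks the starting place \<open>b C \<in> C\<close> of the first
  strand of \<open>C\<close>; each further strand starts where the previous one ends.
\<close>

type_synonym strand = "nat set \<times> nat"

definition strands :: "nat \<Rightarrow> letter list \<Rightarrow> strand set" where
  "strands s w = (SIGMA C : closure_components s w. {..<card C})"

definition strand_place :: "letter list \<Rightarrow> (nat set \<Rightarrow> nat) \<Rightarrow> nat \<Rightarrow> strand \<Rightarrow> nat" where
  "strand_place w b k S =
     word_pos w k ((word_pos w (length w) ^^ snd S) (b (fst S)))"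

section \<open>Trigonometric interpolation\<close>

definition trig_poly :: "nat \<Rightarrow> (real \<Rightarrow> real) \<Rightarrow> bool" where
  "trig_poly n p \<longleftrightarrow> (\<exists>a b :: nat \<Rightarrow> real. \<forall>u.
     p u = a 0 + (\<Sum>m=1..n. a m * cos (real m * u) + b m * sin (real m * u)))"

text \<open>
  Interpolation of \<open>N\<close> conditions uses degree \<open>(N-1)/2\<close> for odd \<open>N\<close> and \<open>N/2\<close> for even \<open>N\<close>. (In
  the even case the interpolant is not unique, and any one is admitted.)
\<close>

definition trig_interpolates :: "(real \<times> real) set \<Rightarrow> (real \<Rightarrow> real) \<Rightarrow> bool" where
  "trig_interpolates D p \<longleftrightarrow> finite D \<and> trig_poly (card D div 2) p \<and> (\<forall>(u, v)\<in>D. p u = v)"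

text \<open>Each triple (parameter, value, derivative) accounts for two conditions.\<close>

definition trig_hermite_interpolates ::
    "(real \<times> real \<times> real) set \<Rightarrow> (real \<Rightarrow> real) \<Rightarrow> bool" where
  "trig_hermite_interpolates D p \<longleftrightarrow> finite D \<and> trig_poly ((2 * card D) div 2) p \<and>
     (\<forall>(u, v, d)\<in>D. p u = v \<and> (p has_real_derivative d) (at u))"

section \<open>The interpolation algorithm\<close>

definition strand_param :: "strand \<Rightarrow> real \<Rightarrow> real" where
  "strand_param S t = (t + 2*pi * real (snd S)) / real (card (fst S))"

definition on_strand :: "(nat set \<Rightarrow> real \<Rightarrow> real) \<Rightarrow> strand \<Rightarrow> real \<Rightarrow> real" where
  "on_strand F S t = F (fst S) (strand_param S t)"

definition interval :: "letter list \<Rightarrow> nat \<Rightarrow> real set" where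
  "interval w k = {2*pi * real k / real (length w) .. 2*pi * real (k+1) / real (length w)}"

text \<open>\<open>S\<close> and \<open>S'\<close> are the strands at places \<open>i\<close> and \<open>i+1\<close> just before the \<open>k\<close>th crossing (counted
  from \<open>0\<close>), whose letter has index \<open>i\<close>.\<close>

definition crossing_strands ::
    "nat \<Rightarrow> letter list \<Rightarrow> (nat set \<Rightarrow> nat) \<Rightarrow> nat \<Rightarrow> strand \<Rightarrow> strand \<Rightarrow> bool" where
  "crossing_strands s w b k S S' \<longleftrightarrow> k < length w \<and> S \<in> strands s w \<and> S' \<in> strands s w \<and>
     strand_place w b k S = idx (w!k) \<and> strand_place w b k S' = Suc (idx (w!k))"

definition in_sigma_crossing ::
    "nat \<Rightarrow> letter list \<Rightarrow> (nat set \<Rightarrow> nat) \<Rightarrow> nat \<Rightarrow> strand \<Rightarrow> bool" where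
  "in_sigma_crossing s w b k S \<longleftrightarrow> k < length w \<and> is_sigma (w!k) \<and>
     (\<exists>S'. crossing_strands s w b k S S' \<or> crossing_strands s w b k S' S)"

subsection \<open>Step 1\<close>

text \<open>\<open>X q\<close> is the \<open>x\<close>-coordinate of the \<open>q\<close>th place in the diagram.\<close>

definition step1 :: "nat \<Rightarrow> letter list \<Rightarrow> (nat set \<Rightarrow> nat) \<Rightarrow> (nat \<Rightarrow> real) \<Rightarrow>
    (nat set \<Rightarrow> real \<Rightarrow> real) \<Rightarrow> bool" where
  "step1 s w b X F \<longleftrightarrow> strict_mono_on {1..s} X \<and>
     (\<forall>C\<in>closure_components s w.
        trig_interpolates
          {(strand_param (C, j) (2*pi * real k / real (length w)), X (strand_place w b k (C, j))) |
             j k. j < card C \<and> k < length w} (F C))"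

subsection \<open>Step 2\<close>

text \<open>The time of the first crossing of \<open>B'\<close> in the \<open>k\<close>th interval between the two strands of the
  \<open>k\<close>th crossing of \<open>B\<close>.\<close>

definition crossing_time :: "nat \<Rightarrow> letter list \<Rightarrow> (nat set \<Rightarrow> nat) \<Rightarrow>
    (nat set \<Rightarrow> real \<Rightarrow> real) \<Rightarrow> nat \<Rightarrow> real" where
  "crossing_time s w b F k =
     Inf {t \<in> interval w k. \<exists>S S'. crossing_strands s w b k S S' \<and> on_strand F S t = on_strand F S' t}"

definition overpasses ::
    "nat \<Rightarrow> letter list \<Rightarrow> (nat set \<Rightarrow> nat) \<Rightarrow> nat \<Rightarrow> strand \<Rightarrow> strand \<Rightarrow> bool" where
  "overpasses s w b k S S' \<longleftrightarrow>
     (if positive (w!k) then crossing_strands s w b k S S' else crossing_strands s w b k S' S)"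

text \<open>\<open>y S k\<close> is the real assigned to the strand \<open>S\<close> for the \<open>k\<close>th interval, and \<open>m k\<close> the common
  value of the two strands of the \<open>k\<close>th crossing if it is a \<open>\<sigma>\<close>-crossing.\<close>

definition heights :: "nat \<Rightarrow> letter list \<Rightarrow> (nat set \<Rightarrow> nat) \<Rightarrow> (strand \<Rightarrow> nat \<Rightarrow> real) \<Rightarrow>
    (nat \<Rightarrow> real) \<Rightarrow> bool" where
  "heights s w b y m \<longleftrightarrow> (\<forall>k<length w.
     inj_on (\<lambda>S. y S k) (strands s w) \<and>
     (\<not> is_sigma (w!k) \<longrightarrow> (\<forall>S S'. overpasses s w b k S S' \<longrightarrow> y S k > y S' k)) \<and>
     (is_sigma (w!k) \<longrightarrow> (\<forall>S S'. crossing_strands s w b k S S' \<longrightarrow>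
        min (y S k) (y S' k) < m k \<and> m k < max (y S k) (y S' k) \<and>
        (\<forall>S''\<in>strands s w.
           \<not> (min (y S k) (y S' k) < y S'' k \<and> y S'' k < max (y S k) (y S' k))))))"

definition step2 :: "nat \<Rightarrow> letter list \<Rightarrow> (nat set \<Rightarrow> nat) \<Rightarrow> (nat set \<Rightarrow> real \<Rightarrow> real) \<Rightarrow>
    (nat set \<Rightarrow> real \<Rightarrow> real) \<Rightarrow> bool" where
  "step2 s w b F G \<longleftrightarrow> (\<exists>y m. heights s w b y m \<and>
     (\<forall>C\<in>closure_components s w.
        trig_interpolates
          {(strand_param (C, j) t,
            if in_sigma_crossing s w b k (C, j) \<and> t = crossing_time s w b F k
            then m k else y (C, j) k) |
             j k t. j < card C \<and> k < length w \<and> t \<in> interval w k \<and>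
               (\<exists>S'\<in>strands s w. S' \<noteq> (C, j) \<and> on_strand F (C, j) t = on_strand F S' t)}
          (G C)))"

subsection \<open>Steps 3 and 4\<close>

text \<open>
  At a \<open>\<sigma>\<close>-crossing of either sign the strand \<open>S\<close> going from place \<open>i\<close> to place \<open>i+1\<close> comes from
  above relative to the other one \<open>S'\<close>: for \<open>\<sigma>\<^sub>i\<close> it passes downwards through the hole of \<open>S'\<close>,
  for its inverse \<open>S'\<close> passes upwards through the hole of \<open>S\<close>. The number \<open>d S k\<close> is the slope
  \<open>dz/dt\<close> of the strand; the chain rule turns it into the derivative \<open>s\<^sub>C * d S k\<close> of \<open>H\<^sub>C\<close>.
\<close>

definition step3 :: "nat \<Rightarrow> letter list \<Rightarrow> (nat set \<Rightarrow> nat) \<Rightarrow> (nat set \<Rightarrow> real \<Rightarrow> real) \<Rightarrow>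
    (nat set \<Rightarrow> real \<Rightarrow> real) \<Rightarrow> bool" where
  "step3 s w b F H \<longleftrightarrow> (\<exists>(h :: nat \<Rightarrow> real) (d :: strand \<Rightarrow> nat \<Rightarrow> real).
     (\<forall>k<length w. is_sigma (w!k) \<longrightarrow>
        (\<forall>S S'. crossing_strands s w b k S S' \<longrightarrow> d S k < d S' k)) \<and>
     (\<forall>C\<in>closure_components s w.
        trig_hermite_interpolates
          {(strand_param (C, j) (crossing_time s w b F k), h k, real (card C) * d (C, j) k) |
             j k. j < card C \<and> k < length w \<and> in_sigma_crossing s w b k (C, j)} (H C)))"

definition strand_circle :: "(nat set \<Rightarrow> real \<Rightarrow> real) \<Rightarrow> (nat set \<Rightarrow> real \<Rightarrow> real) \<Rightarrow>
    (nat set \<Rightarrow> real \<Rightarrow> real) \<Rightarrow> (nat set \<Rightarrow> real \<Rightarrow> real) \<Rightarrow> strand \<Rightarrow> real \<Rightarrow> circle" where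
  "strand_circle F G H R S t =
     (vector [on_strand F S t, on_strand G S t, on_strand H S t], on_strand R S t)"

definition circles_disjoint :: "nat \<Rightarrow> letter list \<Rightarrow> (nat set \<Rightarrow> real \<Rightarrow> real) \<Rightarrow>
    (nat set \<Rightarrow> real \<Rightarrow> real) \<Rightarrow> (nat set \<Rightarrow> real \<Rightarrow> real) \<Rightarrow> (nat set \<Rightarrow> real \<Rightarrow> real) \<Rightarrow> bool" where
  "circles_disjoint s w F G H R \<longleftrightarrow>
     (\<forall>t\<in>{0..2*pi}. \<forall>S\<in>strands s w. \<forall>S'\<in>strands s w. S \<noteq> S' \<longrightarrow>
        circle_set (strand_circle F G H R S t) \<inter> circle_set (strand_circle F G H R S' t) = {})"

definition step4 :: "nat \<Rightarrow> letter list \<Rightarrow> (nat set \<Rightarrow> nat) \<Rightarrow> (nat set \<Rightarrow> real \<Rightarrow> real) \<Rightarrow>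
    (nat set \<Rightarrow> real \<Rightarrow> real) \<Rightarrow> (nat set \<Rightarrow> real \<Rightarrow> real) \<Rightarrow> (nat set \<Rightarrow> real \<Rightarrow> real) \<Rightarrow> bool" where
  "step4 s w b F G H R \<longleftrightarrow>
     (\<exists>(r :: strand \<Rightarrow> nat \<Rightarrow> real) (R\<^sub>0 :: nat set \<Rightarrow> real \<Rightarrow> real) (\<kappa> :: real) (\<mu> :: real).
     (\<forall>k<length w. is_sigma (w!k) \<longrightarrow>
        (\<forall>S S'. crossing_strands s w b k S S' \<longrightarrow>
           (if positive (w!k) then r S k < r S' k else r S' k < r S k))) \<and>
     (\<forall>C\<in>closure_components s w.
        trig_interpolates
          {(strand_param (C, j) (crossing_time s w b F k), r (C, j) k) |
             j k. j < card C \<and> k < length w \<and> in_sigma_crossing s w b k (C, j)} (R\<^sub>0 C)) \<and>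
     (\<forall>C\<in>closure_components s w. \<forall>u. R\<^sub>0 C u + \<kappa> > 0) \<and>
     0 < \<mu> \<and>
     (\<forall>\<nu>\<in>{0<..\<mu>}. circles_disjoint s w F G H (\<lambda>C u. \<nu> * (R\<^sub>0 C u + \<kappa>))) \<and>
     R = (\<lambda>C u. \<mu> * (R\<^sub>0 C u + \<kappa>)))"

subsection \<open>Steps 5 and 6\<close>

definition circle_poly :: "circle \<Rightarrow> real^3 \<Rightarrow> complex" where
  "circle_poly c p =
     complex_of_real ((p$1 - fst c$1)^2 + (p$2 - fst c$2)^2 - (snd c)^2)
       + \<i> * complex_of_real (p$3 - fst c$3)"

definition braid_poly :: "nat \<Rightarrow> letter list \<Rightarrow> (nat set \<Rightarrow> real \<Rightarrow> real) \<Rightarrow>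
    (nat set \<Rightarrow> real \<Rightarrow> real) \<Rightarrow> (nat set \<Rightarrow> real \<Rightarrow> real) \<Rightarrow> (nat set \<Rightarrow> real \<Rightarrow> real) \<Rightarrow>
    real \<Rightarrow> real^3 \<Rightarrow> real \<Rightarrow> complex" where
  "braid_poly s w F G H R lam p t =
     (\<Prod>S\<in>strands s w. circle_poly (strand_circle F G H R S t) ((1 / lam) *\<^sub>R p))"

text \<open>
  \<open>g\<close> is expanded as a Laurent polynomial in \<open>e\<^sup>i\<^sup>t\<close> with coefficients polynomial in \<open>x, y, z\<close>
  (these are unique), and \<open>e\<^sup>i\<^sup>k\<^sup>t\<close> is replaced by a power of \<open>v\<close> or of its conjugate according to
  the sign of \<open>k\<close>.
\<close>

definition laurent_substitution ::
    "(real^3 \<Rightarrow> real \<Rightarrow> complex) \<Rightarrow> ((real^3) \<times> complex \<Rightarrow> complex) \<Rightarrow> bool" where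
  "laurent_substitution g f \<longleftrightarrow> (\<exists>(N :: int) (c :: int \<Rightarrow> real^3 \<Rightarrow> complex).
     (\<forall>k. polynomial_function (c k)) \<and>
     (\<forall>p t. g p t = (\<Sum>k\<in>{-N..N}. c k p * cis (of_int k * t))) \<and>
     (\<forall>p v. f (p, v) =
        (\<Sum>k\<in>{-N..N}. c k p * (if k \<ge> 0 then v ^ nat k else cnj v ^ nat (- k)))))"

definition algorithm_output ::
    "nat \<Rightarrow> motion set \<Rightarrow> letter list \<Rightarrow> ((real^3) \<times> complex \<Rightarrow> complex) \<Rightarrow> bool" where
  "algorithm_output s B w f \<longleftrightarrow> (\<exists>b X F G H R lam.
     (\<forall>C\<in>closure_components s w. b C \<in> C) \<and>
     step1 s w b X F \<and> step2 s w b F G \<and> step3 s w b F H \<and> step4 s w b F G H R \<and>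
     0 < lam \<and> laurent_substitution (braid_poly s w F G H R lam) f \<and>
     (\<exists>\<beta>\<in>B. \<exists>Z. Z \<subseteq> f -` {0} \<inter> sphere 0 1 \<and>
        ambient_isotopic (sphere 0 1) (braid_closure s \<beta>) Z))"

section \<open>The degree of a polynomial map\<close>

text \<open>
  \<open>f\<close> is a linear combination, with coefficients in the target space, of monomials of total degree
  at most \<open>d\<close> in the coordinates. An exponent vector assigns an exponent to each basis vector.
\<close>

definition poly_map_degree_le ::
    "nat \<Rightarrow> ('a::euclidean_space \<Rightarrow> 'b::real_vector) \<Rightarrow> bool" where
  "poly_map_degree_le d f \<longleftrightarrow> (\<exists>c :: ('a \<Rightarrow> nat) \<Rightarrow> 'b. \<forall>u.
     f u = (\<Sum>\<alpha> | \<alpha> \<in> Basis \<rightarrow>\<^sub>E UNIV \<and> sum \<alpha> Basis \<le> d.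
              (\<Prod>e\<in>Basis. (u \<bullet> e) ^ \<alpha> e) *\<^sub>R c \<alpha>))"

definition poly_map_degree :: "('a::euclidean_space \<Rightarrow> 'b::real_vector) \<Rightarrow> nat" where
  "poly_map_degree f = (LEAST d. poly_map_degree_le d f)"

end

theory Submission
  imports Defs
begin

text \<open>
  Give a monomial \<open>x\<^sup>\<alpha> e\<^sup>i\<^sup>\<theta>\<^sup>t\<close> the weight \<open>\<bar>\<alpha>\<bar> + \<bar>\<theta>\<bar>\<close>, for arbitrary real frequencies \<open>\<theta>\<close>. Weights are
  subadditive under multiplication, and the substitution of \<open>v\<close> for \<open>e\<^sup>i\<^sup>t\<close> turns the weight of a
  Laurent polynomial into the degree of the resulting polynomial. So the task is to bound the weight
  of the product \<open>g\<^sub>\<lambda>\<close>.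

  Let \<open>M\<^sub>C\<close> be the maximum in the bound. If \<open>F\<^sub>C\<close>, \<open>G\<^sub>C\<close> and \<open>R\<^sub>C\<close> have trigonometric degree at most \<open>M\<^sub>C\<close>
  and \<open>H\<^sub>C\<close> has degree at most \<open>2M\<^sub>C\<close>, then, as a strand reads them at \<open>(t + const)/s\<^sub>C\<close>, and as \<open>s\<^sub>C \<le> M\<^sub>C\<close>
  gives room for the coordinates \<open>x, y, z\<close>, each factor \<open>P\<^sub>C\<^sub>,\<^sub>j\<close> has weight at most \<open>2M\<^sub>C/s\<^sub>C\<close>. The \<open>s\<^sub>C\<close>
  factors of \<open>C\<close> contribute \<open>2M\<^sub>C\<close>, and the weight of \<open>g\<^sub>\<lambda>\<close> is at most \<open>2\<Sum>M\<^sub>C\<close> (lemma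
  \<open>exp_poly_braid_poly\<close>). The factors contain frequencies that are not integers. In the product they
  cancel, and no computation is needed to see this: distinct characters \<open>e\<^sup>i\<^sup>\<theta>\<^sup>t\<close> are linearly
  independent, so the coefficients of the Laurent expansion are those of the weighted one (lemma
  \<open>poly_map_degree_le_laurent_substitution\<close>).

  The degrees of \<open>F\<^sub>C\<close>, \<open>H\<^sub>C\<close> and \<open>R\<^sub>C\<close> are bounded through \<open>s\<^sub>C l\<close>, the number of pairs of a strand of \<open>C\<close>
  and a letter. For \<open>G\<^sub>C\<close> one has to count the crossings of \<open>B'\<close> on \<open>C\<close>. They are the zeros, over the
  period \<open>2\<pi>s\<^sub>C\<close>, of the product of the differences between the first strand of \<open>C\<close> and all other
  strands. This product has weight at most \<open>(s - 1) l / 2\<close>, and a periodic function of weight \<open>W\<close> has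
  at most \<open>W P / \<pi>\<close> zeros in a period \<open>P\<close> (lemma \<open>card_zeros_exp_poly_le\<close>). This gives at most
  \<open>s\<^sub>C l (s - 1)\<close> data points, which fits the bound unless \<open>s\<^sub>C = l = 1\<close>. In that case the only letter
  leaves, for \<open>s \<ge> 4\<close>, another strand constant besides \<open>C\<close>, and the corresponding constant factor
  lowers the count.
\<close>

section \<open>Degrees of polynomial maps\<close>

definition monomial_map :: "('a::euclidean_space \<Rightarrow> nat) \<Rightarrow> 'a \<Rightarrow> real" where
  "monomial_map \<alpha> u = (\<Prod>e\<in>Basis. (u \<bullet> e) ^ \<alpha> e)"

definition exponents_le :: "nat \<Rightarrow> ('a::euclidean_space \<Rightarrow> nat) set" where
  "exponents_le d = {\<alpha>. \<alpha> \<in> Basis \<rightarrow>\<^sub>E UNIV \<and> sum \<alpha> Basis \<le> d}"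

lemma finite_exponents_le: "finite (exponents_le d :: ('a::euclidean_space \<Rightarrow> nat) set)"
proof (rule finite_subset)
  show "(exponents_le d :: ('a \<Rightarrow> nat) set) \<subseteq> Basis \<rightarrow>\<^sub>E {..d}"
  proof
    fix \<alpha> :: "'a \<Rightarrow> nat" assume \<alpha>: "\<alpha> \<in> exponents_le d"
    have "\<alpha> e \<le> d" if "e \<in> Basis" for e
      using \<alpha> that member_le_sum[of e Basis \<alpha>] by (auto simp: exponents_le_def)
    then show "\<alpha> \<in> Basis \<rightarrow>\<^sub>E {..d}"
      using \<alpha> by (auto simp: exponents_le_def PiE_iff)
  qed
qed (auto intro: finite_PiE)

lemma poly_map_degree_le_iff:
  "poly_map_degree_le d f \<longleftrightarrow> (\<exists>c. \<forall>u. f u = (\<Sum>\<alpha>\<in>exponents_le d. monomial_map \<alpha> u *\<^sub>R c \<alpha>))"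
  by (simp add: poly_map_degree_le_def monomial_map_def exponents_le_def)

lemma poly_map_degree_leE:
  assumes "poly_map_degree_le d f"
  obtains c where "f = (\<lambda>u. \<Sum>\<alpha>\<in>exponents_le d. monomial_map \<alpha> u *\<^sub>R c \<alpha>)"
  using assms by (auto simp: poly_map_degree_le_iff fun_eq_iff)

lemma poly_map_degree_le_monomial:
  assumes "\<alpha> \<in> exponents_le d"
  shows "poly_map_degree_le d (\<lambda>u. monomial_map \<alpha> u *\<^sub>R k)"
proof -
  have "monomial_map \<alpha> u *\<^sub>R k
      = (\<Sum>\<beta>\<in>exponents_le d. monomial_map \<beta> u *\<^sub>R (if \<beta> = \<alpha> then k else 0))" for u
    using assms by (simp add: if_distrib [where f = "\<lambda>x. _ *\<^sub>R x"] finite_exponents_le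
        sum.delta cong: if_cong)
  then show ?thesis
    unfolding poly_map_degree_le_iff by (intro exI [of _ "\<lambda>\<beta>. if \<beta> = \<alpha> then k else 0"]) blast
qed

lemma poly_map_degree_le_zero: "poly_map_degree_le d (\<lambda>u. 0)"
  unfolding poly_map_degree_le_iff by (rule exI [of _ "\<lambda>_. 0"]) simp

lemma poly_map_degree_le_add:
  assumes "poly_map_degree_le d f" "poly_map_degree_le d g"
  shows "poly_map_degree_le d (\<lambda>u. f u + g u)"
proof -
  obtain a where a: "f = (\<lambda>u. \<Sum>\<alpha>\<in>exponents_le d. monomial_map \<alpha> u *\<^sub>R a \<alpha>)"
    using assms(1) by (rule poly_map_degree_leE)
  obtain b where b: "g = (\<lambda>u. \<Sum>\<alpha>\<in>exponents_le d. monomial_map \<alpha> u *\<^sub>R b \<alpha>)"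
    using assms(2) by (rule poly_map_degree_leE)
  show ?thesis
    unfolding poly_map_degree_le_iff
    by (rule exI [of _ "\<lambda>\<alpha>. a \<alpha> + b \<alpha>"]) (simp add: a b scaleR_add_right sum.distrib)
qed

lemma poly_map_degree_le_sum:
  assumes "\<And>i. i \<in> I \<Longrightarrow> poly_map_degree_le d (f i)"
  shows "poly_map_degree_le d (\<lambda>u. \<Sum>i\<in>I. f i u)"
  using assms
  by (induction I rule: infinite_finite_induct)
     (auto intro: poly_map_degree_le_zero poly_map_degree_le_add)

lemma poly_map_degree_le_mono:
  assumes "poly_map_degree_le d f" "d \<le> d'"
  shows "poly_map_degree_le d' f"
proof -
  obtain c where c: "f = (\<lambda>u. \<Sum>\<alpha>\<in>exponents_le d. monomial_map \<alpha> u *\<^sub>R c \<alpha>)"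
    using assms(1) by (rule poly_map_degree_leE)
  show ?thesis
    unfolding c using assms(2)
    by (intro poly_map_degree_le_sum poly_map_degree_le_monomial) (auto simp: exponents_le_def)
qed

lemma poly_map_degree_le_mult:
  fixes f g :: "'a::euclidean_space \<Rightarrow> 'b::real_algebra"
  assumes "poly_map_degree_le d f" "poly_map_degree_le d' g"
  shows "poly_map_degree_le (d + d') (\<lambda>u. f u * g u)"
proof -
  obtain a where a: "f = (\<lambda>u. \<Sum>\<alpha>\<in>exponents_le d. monomial_map \<alpha> u *\<^sub>R a \<alpha>)"
    using assms(1) by (rule poly_map_degree_leE)
  obtain b where b: "g = (\<lambda>u. \<Sum>\<alpha>\<in>exponents_le d'. monomial_map \<alpha> u *\<^sub>R b \<alpha>)"
    using assms(2) by (rule poly_map_degree_leE)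
  let ?add = "\<lambda>\<alpha> \<beta> :: 'a \<Rightarrow> nat. restrict (\<lambda>e. \<alpha> e + \<beta> e) Basis"
  have add: "monomial_map \<alpha> u * monomial_map \<beta> u = monomial_map (?add \<alpha> \<beta>) u" for \<alpha> \<beta> u
    unfolding monomial_map_def prod.distrib [symmetric]
    by (rule prod.cong) (auto simp: power_add)
  have "f u * g u = (\<Sum>\<alpha>\<in>exponents_le d. \<Sum>\<beta>\<in>exponents_le d'.
      monomial_map (?add \<alpha> \<beta>) u *\<^sub>R (a \<alpha> * b \<beta>))" for u
    by (simp add: a b sum_product add [symmetric] mult.commute)
  moreover have "?add \<alpha> \<beta> \<in> exponents_le (d + d')"
    if "\<alpha> \<in> exponents_le d" "\<beta> \<in> exponents_le d'" for \<alpha> \<beta>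
    using that by (auto simp: exponents_le_def sum.distrib)
  ultimately show ?thesis
    by (auto intro!: poly_map_degree_le_sum poly_map_degree_le_monomial)
qed

lemma poly_map_degree_le_const: "poly_map_degree_le d (\<lambda>u::'a::euclidean_space. k)"
proof -
  have "(restrict (\<lambda>_. 0) Basis :: 'a \<Rightarrow> nat) \<in> exponents_le d"
    by (auto simp: exponents_le_def)
  moreover have "monomial_map (restrict (\<lambda>_. 0) Basis) u = 1" for u :: 'a
    unfolding monomial_map_def by (rule prod.neutral) simp
  ultimately show ?thesis
    using poly_map_degree_le_monomial [of "restrict (\<lambda>_. 0) Basis :: 'a \<Rightarrow> nat" d k] by simp
qed

lemma poly_map_degree_le_linear:
  fixes f :: "'a::euclidean_space \<Rightarrow> 'b::real_vector"
  assumes "linear f" "1 \<le> d"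
  shows "poly_map_degree_le d f"
proof -
  let ?\<alpha> = "\<lambda>b::'a. restrict (\<lambda>e. if e = b then 1 else 0) Basis"
  have [simp]: "monomial_map (?\<alpha> b) u = u \<bullet> b" if "b \<in> Basis" for b u
  proof -
    have "monomial_map (?\<alpha> b) u = (\<Prod>e\<in>Basis. if e = b then u \<bullet> e else 1)"
      unfolding monomial_map_def by (rule prod.cong) auto
    then show ?thesis
      using that by (simp add: prod.delta)
  qed
  have "f = (\<lambda>u. \<Sum>b\<in>Basis. monomial_map (?\<alpha> b) u *\<^sub>R f b)"
  proof
    fix u
    have "f u = f (\<Sum>b\<in>Basis. (u \<bullet> b) *\<^sub>R b)"
      by (simp add: euclidean_representation)
    then show "f u = (\<Sum>b\<in>Basis. monomial_map (?\<alpha> b) u *\<^sub>R f b)"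
      using assms(1) by (simp add: linear_sum linear_scale)
  qed
  moreover have "?\<alpha> b \<in> exponents_le d" if "b \<in> Basis" for b
    using that assms(2) by (auto simp: exponents_le_def)
  then have "poly_map_degree_le d (\<lambda>u. \<Sum>b\<in>Basis. monomial_map (?\<alpha> b) u *\<^sub>R f b)"
    by (intro poly_map_degree_le_sum poly_map_degree_le_monomial)
  ultimately show ?thesis
    by simp
qed

lemma poly_map_degree_le_power:
  fixes f :: "'a::euclidean_space \<Rightarrow> 'b::real_algebra_1"
  assumes "poly_map_degree_le d f"
  shows "poly_map_degree_le (n * d) (\<lambda>u. f u ^ n)"
proof (induction n)
  case (Suc n)
  then show ?case
    using poly_map_degree_le_mult [OF assms Suc] by simp
qed (simp add: poly_map_degree_le_const)

lemma poly_map_degree_le_prod: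
  fixes f :: "'i \<Rightarrow> 'a::euclidean_space \<Rightarrow> 'b::{real_algebra_1,comm_ring_1}"
  assumes "\<And>i. i \<in> I \<Longrightarrow> poly_map_degree_le (d i) (f i)"
  shows "poly_map_degree_le (sum d I) (\<lambda>u. \<Prod>i\<in>I. f i u)"
  using assms
  by (induction I rule: infinite_finite_induct)
     (auto intro: poly_map_degree_le_const poly_map_degree_le_mult)

lemma poly_map_degree_le_scaleR:
  fixes f :: "'a::euclidean_space \<Rightarrow> real"
  assumes "poly_map_degree_le d f"
  shows "poly_map_degree_le d (\<lambda>u. f u *\<^sub>R k)"
proof -
  obtain a where a: "f = (\<lambda>u. \<Sum>\<alpha>\<in>exponents_le d. monomial_map \<alpha> u *\<^sub>R a \<alpha>)"
    using assms by (rule poly_map_degree_leE)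
  have "f u *\<^sub>R k = (\<Sum>\<alpha>\<in>exponents_le d. monomial_map \<alpha> u *\<^sub>R (a \<alpha> *\<^sub>R k))" for u
    by (simp add: a scaleR_sum_left)
  then show ?thesis
    unfolding poly_map_degree_le_iff by (intro exI [of _ "\<lambda>\<alpha>. a \<alpha> *\<^sub>R k"]) blast
qed

lemma poly_map_degree_le_compose_linear:
  fixes L :: "'c::euclidean_space \<Rightarrow> 'a::euclidean_space"
  assumes "poly_map_degree_le d q" "linear L"
  shows "poly_map_degree_le d (\<lambda>u. q (L u))"
proof -
  obtain a where a: "q = (\<lambda>u. \<Sum>\<alpha>\<in>exponents_le d. monomial_map \<alpha> u *\<^sub>R a \<alpha>)"
    using assms(1) by (rule poly_map_degree_leE)
  have "poly_map_degree_le d (\<lambda>u. monomial_map \<alpha> (L u))" if "\<alpha> \<in> exponents_le d" for \<alpha>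
  proof -
    have "poly_map_degree_le 1 (\<lambda>u. L u \<bullet> e)" for e
      using assms(2)
      by (intro poly_map_degree_le_linear linearI)
         (simp_all add: linear_add linear_scale inner_add_left)
    then have "poly_map_degree_le (\<Sum>e\<in>Basis. \<alpha> e * 1) (\<lambda>u. monomial_map \<alpha> (L u))"
      unfolding monomial_map_def by (intro poly_map_degree_le_prod poly_map_degree_le_power)
    then show ?thesis
      using that by (auto simp: exponents_le_def intro: poly_map_degree_le_mono)
  qed
  then show ?thesis
    unfolding a by (intro poly_map_degree_le_sum poly_map_degree_le_scaleR)
qed

section \<open>Exponential polynomials\<close>

text \<open>
  Polynomials in \<open>p\<close> and the characters \<open>e\<^sup>i\<^sup>\<theta>\<^sup>t\<close>, filtered by the weight (degree in \<open>p\<close>) + \<open>\<bar>\<theta>\<bar>\<close>.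
  Frequencies are arbitrary reals because a strand of \<open>C\<close> reads its interpolants at
  \<open>(t + const) / s\<^sub>C\<close>, which turns integer frequencies into multiples of \<open>1 / s\<^sub>C\<close>. Setting \<open>c \<theta> = 0\<close>
  off \<open>\<Theta>\<close> lets two expansions be compared frequency by frequency without matching their supports.
\<close>

definition exp_poly :: "real \<Rightarrow> ('a::euclidean_space \<Rightarrow> real \<Rightarrow> complex) \<Rightarrow> bool" where
  "exp_poly W g \<longleftrightarrow> (\<exists>\<Theta> c. finite \<Theta> \<and> (\<forall>\<theta>\<in>\<Theta>. \<bar>\<theta>\<bar> \<le> W) \<and>
     (\<forall>\<theta>\<in>\<Theta>. poly_map_degree_le (nat \<lfloor>W - \<bar>\<theta>\<bar>\<rfloor>) (c \<theta>)) \<and>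
     (\<forall>\<theta> p. \<theta> \<notin> \<Theta> \<longrightarrow> c \<theta> p = 0) \<and>
     (\<forall>p t. g p t = (\<Sum>\<theta>\<in>\<Theta>. c \<theta> p * cis (\<theta> * t))))"

lemma exp_polyE:
  assumes "exp_poly W g"
  obtains \<Theta> c where "finite \<Theta>" "\<forall>\<theta>\<in>\<Theta>. \<bar>\<theta>\<bar> \<le> W"
    "\<forall>\<theta>\<in>\<Theta>. poly_map_degree_le (nat \<lfloor>W - \<bar>\<theta>\<bar>\<rfloor>) (c \<theta>)"
    "\<forall>\<theta> p. \<theta> \<notin> \<Theta> \<longrightarrow> c \<theta> p = 0"
    "g = (\<lambda>p t. \<Sum>\<theta>\<in>\<Theta>. c \<theta> p * cis (\<theta> * t))"
proof -
  obtain \<Theta> c where *: "finite \<Theta>" "\<forall>\<theta>\<in>\<Theta>. \<bar>\<theta>\<bar> \<le> W"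
    "\<forall>\<theta>\<in>\<Theta>. poly_map_degree_le (nat \<lfloor>W - \<bar>\<theta>\<bar>\<rfloor>) (c \<theta>)"
    "\<forall>\<theta> p. \<theta> \<notin> \<Theta> \<longrightarrow> c \<theta> p = 0"
    "\<forall>p t. g p t = (\<Sum>\<theta>\<in>\<Theta>. c \<theta> p * cis (\<theta> * t))"
    using assms unfolding exp_poly_def by blast
  show thesis
  proof (rule that)
    show "g = (\<lambda>p t. \<Sum>\<theta>\<in>\<Theta>. c \<theta> p * cis (\<theta> * t))"
      using *(5) by (intro ext) simp
  qed (use * in auto)
qed

lemma exp_poly_term:
  assumes "poly_map_degree_le d q" "real d + \<bar>\<theta>\<bar> \<le> W"
  shows "exp_poly W (\<lambda>p t. q p * cis (\<theta> * t))"
proof -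
  have "poly_map_degree_le (nat \<lfloor>W - \<bar>\<theta>\<bar>\<rfloor>) q"
    using assms by (auto intro!: poly_map_degree_le_mono [OF assms(1)] simp: le_nat_floor)
  then show ?thesis
    unfolding exp_poly_def using assms(2)
    by (intro exI [of _ "{\<theta>}"] exI [of _ "\<lambda>\<eta>. if \<eta> = \<theta> then q else (\<lambda>_. 0)"]) auto
qed

lemma exp_poly_zero: "exp_poly W (\<lambda>p t. 0)"
  unfolding exp_poly_def by (intro exI [of _ "{}"] exI [of _ "\<lambda>_ _. 0"]) auto

lemma exp_poly_add:
  assumes "exp_poly W g" "exp_poly W h"
  shows "exp_poly W (\<lambda>p t. g p t + h p t)"
proof -
  obtain A a where A: "finite A" "\<forall>\<theta>\<in>A. \<bar>\<theta>\<bar> \<le> W"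
    "\<forall>\<theta>\<in>A. poly_map_degree_le (nat \<lfloor>W - \<bar>\<theta>\<bar>\<rfloor>) (a \<theta>)"
    "\<forall>\<theta> p. \<theta> \<notin> A \<longrightarrow> a \<theta> p = 0"
    "g = (\<lambda>p t. \<Sum>\<theta>\<in>A. a \<theta> p * cis (\<theta> * t))"
    using assms(1) by (rule exp_polyE)
  obtain B b where B: "finite B" "\<forall>\<theta>\<in>B. \<bar>\<theta>\<bar> \<le> W"
    "\<forall>\<theta>\<in>B. poly_map_degree_le (nat \<lfloor>W - \<bar>\<theta>\<bar>\<rfloor>) (b \<theta>)"
    "\<forall>\<theta> p. \<theta> \<notin> B \<longrightarrow> b \<theta> p = 0"
    "h = (\<lambda>p t. \<Sum>\<theta>\<in>B. b \<theta> p * cis (\<theta> * t))"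
    using assms(2) by (rule exp_polyE)
  have zero: "a \<theta> = (\<lambda>_. 0)" if "\<theta> \<notin> A" for \<theta>
    using A(4) that by (intro ext) simp
  have zero': "b \<theta> = (\<lambda>_. 0)" if "\<theta> \<notin> B" for \<theta>
    using B(4) that by (intro ext) simp
  have deg: "poly_map_degree_le (nat \<lfloor>W - \<bar>\<theta>\<bar>\<rfloor>) (a \<theta>)" 
            "poly_map_degree_le (nat \<lfloor>W - \<bar>\<theta>\<bar>\<rfloor>) (b \<theta>)" for \<theta>
    subgoal
      using A(3) zero poly_map_degree_le_zero by (cases "\<theta> \<in> A") simp_all
    subgoal
      using B(3) zero' poly_map_degree_le_zero by (cases "\<theta> \<in> B") simp_all
    done
  have "(\<Sum>\<theta>\<in>A. a \<theta> p * cis (\<theta> * t)) = (\<Sum>\<theta>\<in>A \<union> B. a \<theta> p * cis (\<theta> * t))"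
       "(\<Sum>\<theta>\<in>B. b \<theta> p * cis (\<theta> * t)) = (\<Sum>\<theta>\<in>A \<union> B. b \<theta> p * cis (\<theta> * t))" for p t
    using A(1,4) B(1,4) by (auto intro!: sum.mono_neutral_left)
  then have "g p t + h p t = (\<Sum>\<theta>\<in>A \<union> B. (a \<theta> p + b \<theta> p) * cis (\<theta> * t))" for p t
    by (simp add: A(5) B(5) sum.distrib distrib_right)
  then show ?thesis
    unfolding exp_poly_def using A B deg
    by (intro exI [of _ "A \<union> B"] exI [of _ "\<lambda>\<theta> p. a \<theta> p + b \<theta> p"])
       (auto intro: poly_map_degree_le_add)
qed

lemma exp_poly_sum:
  assumes "\<And>i. i \<in> I \<Longrightarrow> exp_poly W (g i)"
  shows "exp_poly W (\<lambda>p t. \<Sum>i\<in>I. g i p t)"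
  using assms
  by (induction I rule: infinite_finite_induct) (auto intro: exp_poly_zero exp_poly_add)

text \<open>Weights add because degrees add and \<open>\<bar>\<theta> + \<eta>\<bar> \<le> \<bar>\<theta>\<bar> + \<bar>\<eta>\<bar>\<close>.\<close>

lemma exp_poly_mult:
  assumes "exp_poly V g" "exp_poly W h"
  shows "exp_poly (V + W) (\<lambda>p t. g p t * h p t)"
proof -
  obtain A a where A: "finite A" "\<forall>\<theta>\<in>A. \<bar>\<theta>\<bar> \<le> V"
    "\<forall>\<theta>\<in>A. poly_map_degree_le (nat \<lfloor>V - \<bar>\<theta>\<bar>\<rfloor>) (a \<theta>)"
    "\<forall>\<theta> p. \<theta> \<notin> A \<longrightarrow> a \<theta> p = 0"
    "g = (\<lambda>p t. \<Sum>\<theta>\<in>A. a \<theta> p * cis (\<theta> * t))"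
    using assms(1) by (rule exp_polyE)
  obtain B b where B: "finite B" "\<forall>\<theta>\<in>B. \<bar>\<theta>\<bar> \<le> W"
    "\<forall>\<theta>\<in>B. poly_map_degree_le (nat \<lfloor>W - \<bar>\<theta>\<bar>\<rfloor>) (b \<theta>)"
    "\<forall>\<theta> p. \<theta> \<notin> B \<longrightarrow> b \<theta> p = 0"
    "h = (\<lambda>p t. \<Sum>\<theta>\<in>B. b \<theta> p * cis (\<theta> * t))"
    using assms(2) by (rule exp_polyE)
  have eq: "(\<lambda>p t. g p t * h p t) =
      (\<lambda>p t. \<Sum>\<theta>\<in>A. \<Sum>\<eta>\<in>B. (a \<theta> p * b \<eta> p) * cis ((\<theta> + \<eta>) * t))"
    by (simp add: A(5) B(5) sum_product cis_mult [symmetric] distrib_left distrib_right mult_ac)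
  show ?thesis
    unfolding eq
  proof (intro exp_poly_sum exp_poly_term)
    fix \<theta> \<eta> assume \<theta>: "\<theta> \<in> A" and \<eta>: "\<eta> \<in> B"
    show "poly_map_degree_le (nat \<lfloor>V - \<bar>\<theta>\<bar>\<rfloor> + nat \<lfloor>W - \<bar>\<eta>\<bar>\<rfloor>) (\<lambda>p. a \<theta> p * b \<eta> p)"
      by (intro poly_map_degree_le_mult A(3) [rule_format] B(3) [rule_format] \<theta> \<eta>)
    have "real (nat \<lfloor>V - \<bar>\<theta>\<bar>\<rfloor>) \<le> V - \<bar>\<theta>\<bar>" "real (nat \<lfloor>W - \<bar>\<eta>\<bar>\<rfloor>) \<le> W - \<bar>\<eta>\<bar>"
      using A(2) B(2) \<theta> \<eta> by (auto intro!: of_nat_floor)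
    then show "real (nat \<lfloor>V - \<bar>\<theta>\<bar>\<rfloor> + nat \<lfloor>W - \<bar>\<eta>\<bar>\<rfloor>) + \<bar>\<theta> + \<eta>\<bar> \<le> V + W"
      by linarith
  qed
qed

lemma exp_poly_mono:
  assumes "exp_poly V g" "V \<le> W"
  shows "exp_poly W g"
proof -
  obtain A a where A: "finite A" "\<forall>\<theta>\<in>A. \<bar>\<theta>\<bar> \<le> V"
    "\<forall>\<theta>\<in>A. poly_map_degree_le (nat \<lfloor>V - \<bar>\<theta>\<bar>\<rfloor>) (a \<theta>)"
    "\<forall>\<theta> p. \<theta> \<notin> A \<longrightarrow> a \<theta> p = 0"
    "g = (\<lambda>p t. \<Sum>\<theta>\<in>A. a \<theta> p * cis (\<theta> * t))"
    using assms(1) by (rule exp_polyE)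
  have "real (nat \<lfloor>V - \<bar>\<theta>\<bar>\<rfloor>) + \<bar>\<theta>\<bar> \<le> W" if "\<theta> \<in> A" for \<theta>
  proof -
    have "real (nat \<lfloor>V - \<bar>\<theta>\<bar>\<rfloor>) \<le> V - \<bar>\<theta>\<bar>"
      using A(2) that by (auto intro!: of_nat_floor)
    with assms(2) show ?thesis by linarith
  qed
  then show ?thesis
    unfolding A(5) using A(3) by (intro exp_poly_sum exp_poly_term) auto
qed

lemma exp_poly_const: "0 \<le> W \<Longrightarrow> exp_poly W (\<lambda>p t. k)"
  using exp_poly_term [OF poly_map_degree_le_const [of 0 k], of 0 W] by simp

lemma exp_poly_prod:
  assumes "\<And>i. i \<in> I \<Longrightarrow> exp_poly (W i) (g i)"
  shows "exp_poly (sum W I) (\<lambda>p t. \<Prod>i\<in>I. g i p t)"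
  using assms
  by (induction I rule: infinite_finite_induct) (auto intro: exp_poly_const exp_poly_mult)

lemma exp_poly_linear: "linear q \<Longrightarrow> 1 \<le> W \<Longrightarrow> exp_poly W (\<lambda>p t. q p)"
  using exp_poly_term [OF poly_map_degree_le_linear [of q 1], of 0 W] by simp

lemma exp_poly_diff:
  assumes "exp_poly W g" "exp_poly W h"
  shows "exp_poly W (\<lambda>p t. g p t - h p t)"
proof -
  have "exp_poly (0 + W) (\<lambda>p t. (-1) * h p t)"
    by (intro exp_poly_mult exp_poly_const assms) simp
  with exp_poly_add [OF assms(1), of "\<lambda>p t. (-1) * h p t"] show ?thesis
    by simp
qed

section \<open>Linear independence of characters and the substitution\<close>

lemma cis_eq_iff: "cis x = cis y \<longleftrightarrow> (\<exists>n::int. x = y + 2 * pi * n)"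
  using sin_cos_eq_iff [of x y] by (auto simp: complex_eq_iff)

text \<open>
  Shifting \<open>t\<close> by \<open>h\<close> multiplies the \<open>\<theta>\<close>-term by \<open>e\<^sup>i\<^sup>\<theta>\<^sup>h\<close>. Subtracting \<open>e\<^sup>i\<^sup>\<zeta>\<^sup>h\<close> times the original
  relation therefore removes the frequency \<open>\<zeta>\<close>, and with \<open>h = \<pi> / (\<theta> - \<zeta>)\<close> it multiplies \<open>a \<theta>\<close> by
  a nonzero factor, so that induction on the number of frequencies applies.
\<close>

lemma cis_sum_eq_0_imp:
  assumes "finite \<Theta>" "\<And>t. (\<Sum>\<theta>\<in>\<Theta>. a \<theta> * cis (\<theta> * t)) = 0" "\<eta> \<in> \<Theta>"
  shows "a \<eta> = 0"
  using assms
proof (induction \<Theta> arbitrary: a \<eta> rule: finite_induct)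
  case (insert \<zeta> \<Theta>)
  have rest: "a \<theta> = 0" if \<theta>: "\<theta> \<in> \<Theta>" for \<theta>
  proof -
    define h where "h = pi / (\<theta> - \<zeta>)"
    have ne: "\<theta> \<noteq> \<zeta>"
      using \<theta> insert.hyps by auto
    have "(\<Sum>\<theta>\<in>\<Theta>. (a \<theta> * (cis (\<theta> * h) - cis (\<zeta> * h))) * cis (\<theta> * t)) = 0" for t
    proof -
      have "0 = (\<Sum>\<theta>\<in>insert \<zeta> \<Theta>. a \<theta> * cis (\<theta> * (t + h)))
                 - cis (\<zeta> * h) * (\<Sum>\<theta>\<in>insert \<zeta> \<Theta>. a \<theta> * cis (\<theta> * t))"
        by (subst (1 2) insert.prems(1)) simp
      also have "\<dots> = (\<Sum>\<theta>\<in>insert \<zeta> \<Theta>. (a \<theta> * (cis (\<theta> * h) - cis (\<zeta> * h))) * cis (\<theta> * t))"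
        by (simp add: sum_distrib_left sum_subtractf [symmetric] algebra_simps cis_mult [symmetric]
              del: sum.insert)
      finally show ?thesis
        using insert.hyps by simp
    qed
    then have "a \<theta> * (cis (\<theta> * h) - cis (\<zeta> * h)) = 0"
      using insert.IH [of "\<lambda>\<theta>. a \<theta> * (cis (\<theta> * h) - cis (\<zeta> * h))" \<theta>] \<theta> by blast
    moreover have "\<theta> * h = \<zeta> * h + pi"
      using ne by (simp add: h_def field_simps)
    then have "cis (\<theta> * h) = - cis (\<zeta> * h)"
      by (simp add: minus_cis)
    ultimately show ?thesis
      by simp
  qed
  moreover have "a \<zeta> = 0"
    using insert.prems(1) [of 0] insert.hyps rest by simp
  ultimately show ?case
    using insert.prems(2) by auto
qed simp

text \<open>
  A Laurent expansion of \<open>g\<close> in \<open>e\<^sup>i\<^sup>t\<close> is also an expansion in characters, so its coefficient at \<open>k\<close>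
  must be the coefficient \<open>c k\<close> of the weighted expansion, and all terms of non-integer frequency
  have cancelled. Replacing \<open>e\<^sup>i\<^sup>k\<^sup>t\<close> by a power with exponent \<open>\<bar>k\<bar>\<close> turns the weight into the degree.
\<close>

lemma poly_map_degree_le_laurent_substitution:
  assumes "exp_poly W g" "laurent_substitution g f"
  shows "poly_map_degree_le (nat \<lfloor>W\<rfloor>) f"
proof -
  obtain \<Theta> c where c: "finite \<Theta>" "\<forall>\<theta>\<in>\<Theta>. \<bar>\<theta>\<bar> \<le> W"
    "\<forall>\<theta>\<in>\<Theta>. poly_map_degree_le (nat \<lfloor>W - \<bar>\<theta>\<bar>\<rfloor>) (c \<theta>)"
    "\<forall>\<theta> p. \<theta> \<notin> \<Theta> \<longrightarrow> c \<theta> p = 0"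
    "g = (\<lambda>p t. \<Sum>\<theta>\<in>\<Theta>. c \<theta> p * cis (\<theta> * t))"
    using assms(1) by (rule exp_polyE)
  obtain N :: int and c' where
    c': "\<And>p t. g p t = (\<Sum>k\<in>{-N..N}. c' k p * cis (of_int k * t))" and
    f: "\<And>p v. f (p, v) = (\<Sum>k\<in>{-N..N}. c' k p * (if k \<ge> 0 then v ^ nat k else cnj v ^ nat (- k)))"
    using assms(2) unfolding laurent_substitution_def by blast
  have coeff: "c' k p = c (of_int k) p" if k: "k \<in> {-N..N}" for k p
  proof -
    define Z where "Z = real_of_int ` {-N..N}"
    have [simp]: "finite Z"
      by (simp add: Z_def)
    define d where "d = (\<lambda>\<theta>. if \<theta> \<in> Z then c' \<lfloor>\<theta>\<rfloor> p else 0)"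
    have "g p t = (\<Sum>\<theta>\<in>\<Theta> \<union> Z. c \<theta> p * cis (\<theta> * t))" for t
      unfolding c(5) using c(1,4) by (intro sum.mono_neutral_left) auto
    moreover have "g p t = (\<Sum>\<theta>\<in>\<Theta> \<union> Z. d \<theta> * cis (\<theta> * t))" for t
    proof -
      have "g p t = (\<Sum>\<theta>\<in>Z. d \<theta> * cis (\<theta> * t))"
        unfolding c' Z_def by (subst sum.reindex) (auto simp: d_def inj_on_def Z_def)
      also have "\<dots> = (\<Sum>\<theta>\<in>\<Theta> \<union> Z. d \<theta> * cis (\<theta> * t))"
        using c(1) by (intro sum.mono_neutral_left) (auto simp: d_def)
      finally show ?thesis .
    qed
    ultimately have "(\<Sum>\<theta>\<in>\<Theta> \<union> Z. (d \<theta> - c \<theta> p) * cis (\<theta> * t)) = 0" for t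
      by (simp add: left_diff_distrib sum_subtractf)
    then have "d (of_int k) - c (of_int k) p = 0"
      using c(1) k by (intro cis_sum_eq_0_imp [of "\<Theta> \<union> Z" "\<lambda>\<theta>. d \<theta> - c \<theta> p"]) (auto simp: Z_def)
    then show ?thesis
      using k by (simp add: d_def Z_def)
  qed
  have "poly_map_degree_le (nat \<lfloor>W\<rfloor>)
      (\<lambda>u. c' k (fst u) * (if k \<ge> 0 then snd u ^ nat k else cnj (snd u) ^ nat (- k)))"
    if k: "k \<in> {-N..N}" for k
  proof (cases "real_of_int k \<in> \<Theta>")
    case False
    then show ?thesis
      using coeff [OF k] c(4) by (simp add: poly_map_degree_le_zero)
  next
    case True
    let ?d = "nat \<lfloor>W - \<bar>real_of_int k\<bar>\<rfloor>"
    have 1: "poly_map_degree_le ?d (\<lambda>u::(real^3) \<times> complex. c' k (fst u))"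
      using poly_map_degree_le_compose_linear [OF bspec [OF c(3) True] linear_fst] coeff [OF k] by simp
    have lin: "linear (\<lambda>u::(real^3) \<times> complex. snd u)" "linear (\<lambda>u::(real^3) \<times> complex. cnj (snd u))"
      by (auto intro!: linearI)
    have 2: "poly_map_degree_le (nat \<bar>k\<bar> * 1)
       (\<lambda>u::(real^3) \<times> complex. if k \<ge> 0 then snd u ^ nat k else cnj (snd u) ^ nat (- k))"
    proof (cases "k \<ge> 0")
      case True
      then show ?thesis
        using poly_map_degree_le_power [OF poly_map_degree_le_linear [OF lin(1) order_refl], of "nat k"]
        by simp
    next
      case False
      then show ?thesis
        using poly_map_degree_le_power [OF poly_map_degree_le_linear [OF lin(2) order_refl], of "nat (-k)"]
        by simp
    qed
    have "0 \<le> W - \<bar>real_of_int k\<bar>"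
      using c(2) True by auto
    then have "?d + nat \<bar>k\<bar> * 1 \<le> nat \<lfloor>W\<rfloor>"
      by linarith
    then show ?thesis
      by (rule poly_map_degree_le_mono [OF poly_map_degree_le_mult [OF 1 2]])
  qed
  then have "poly_map_degree_le (nat \<lfloor>W\<rfloor>) (\<lambda>u. \<Sum>k\<in>{-N..N}. c' k (fst u) *
      (if k \<ge> 0 then snd u ^ nat k else cnj (snd u) ^ nat (- k)))"
    by (rule poly_map_degree_le_sum)
  moreover have "f = (\<lambda>u. \<Sum>k\<in>{-N..N}. c' k (fst u) *
      (if k \<ge> 0 then snd u ^ nat k else cnj (snd u) ^ nat (- k)))"
    using f by (intro ext) (metis prod.collapse)
  ultimately show ?thesis
    by simp
qed

section \<open>Zeros of periodic exponential polynomials\<close>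

text \<open>
  Periodicity leaves only frequencies in \<open>\<omega>\<int>\<close> with \<open>\<omega> = 2\<pi>/P\<close>, again by independence of characters.
  Hence \<open>g\<close> is, up to a unit, a polynomial of degree at most \<open>2 \<lfloor>W/\<omega>\<rfloor>\<close> in \<open>z = e\<^sup>i\<^sup>\<omega>\<^sup>t\<close>, and \<open>z\<close> determines
  \<open>t\<close> within a period.
\<close>

lemma card_zeros_exp_poly_le:
  assumes "exp_poly W g" and P: "P > 0" and periodic: "\<And>t. g p (t + P) = g p t"
    and "g p t\<^sub>0 \<noteq> 0"
  shows "finite {t \<in> {0..<P}. g p t = 0}"
    and "real (card {t \<in> {0..<P}. g p t = 0}) \<le> W * P / pi"
proof -
  obtain \<Theta> c where c: "finite \<Theta>" "\<forall>\<theta>\<in>\<Theta>. \<bar>\<theta>\<bar> \<le> W"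
    "\<forall>\<theta>\<in>\<Theta>. poly_map_degree_le (nat \<lfloor>W - \<bar>\<theta>\<bar>\<rfloor>) (c \<theta>)"
    "\<forall>\<theta> p. \<theta> \<notin> \<Theta> \<longrightarrow> c \<theta> p = 0"
    "g = (\<lambda>p t. \<Sum>\<theta>\<in>\<Theta>. c \<theta> p * cis (\<theta> * t))"
    using assms(1) by (rule exp_polyE)
  define \<omega> where "\<omega> = 2 * pi / P"
  have \<omega>: "\<omega> > 0"
    using P by (simp add: \<omega>_def)
  define K where "K = nat \<lfloor>W / \<omega>\<rfloor>"
  have integral: "\<theta> = \<omega> * of_int (round (\<theta> / \<omega>))" if "\<theta> \<in> \<Theta>" "c \<theta> p \<noteq> 0" for \<theta>
  proof -
    have "(\<Sum>\<theta>\<in>\<Theta>. c \<theta> p * (cis (\<theta> * P) - 1) * cis (\<theta> * t)) = g p (t + P) - g p t" for t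
      unfolding c(5) sum_subtractf [symmetric]
      by (rule sum.cong) (simp_all add: distrib_left cis_mult [symmetric] right_diff_distrib
          left_diff_distrib mult_ac)
    then have "c \<theta> p * (cis (\<theta> * P) - 1) = 0"
      using cis_sum_eq_0_imp [of \<Theta> "\<lambda>\<theta>. c \<theta> p * (cis (\<theta> * P) - 1)" \<theta>] c(1) that(1)
      by (simp add: periodic)
    then have "cis (\<theta> * P) = cis 0"
      using that(2) by simp
    then obtain n :: int where "\<theta> * P = 2 * pi * n"
      unfolding cis_eq_iff by auto
    then have "\<theta> = \<omega> * n"
      using P by (simp add: \<omega>_def field_simps)
    then show ?thesis
      using \<omega> by simp
  qed
  have range: "\<bar>round (\<theta> / \<omega>)\<bar> \<le> int K" if "\<theta> \<in> \<Theta>" "c \<theta> p \<noteq> 0" for \<theta>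
  proof -
    define k where "k = round (\<theta> / \<omega>)"
    have "\<bar>\<theta>\<bar> \<le> W"
      using that c(2) by auto
    then have "\<bar>of_int k\<bar> \<le> W / \<omega>"
      using integral [OF that] \<omega> by (simp add: k_def [symmetric] field_simps abs_mult)
    then show ?thesis
      unfolding K_def k_def [symmetric] by linarith
  qed
  \<comment> \<open>the shift by \<open>K\<close> clears the negative exponents\<close>
  define q where "q = (\<Sum>\<theta>\<in>{\<theta>\<in>\<Theta>. c \<theta> p \<noteq> 0}. monom (c \<theta> p) (nat (round (\<theta> / \<omega>) + int K)))"
  have q: "poly q (cis (\<omega> * t)) = cis (\<omega> * K * t) * g p t" for t
  proof -
    have "cis (\<omega> * t) ^ nat (round (\<theta> / \<omega>) + int K) = cis (\<omega> * K * t) * cis (\<theta> * t)"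
      if "\<theta> \<in> \<Theta>" "c \<theta> p \<noteq> 0" for \<theta>
    proof -
      have nn: "0 \<le> round (\<theta> / \<omega>) + int K"
        using range [OF that] by linarith
      have "real (nat (round (\<theta> / \<omega>) + int K)) * (\<omega> * t)
          = (\<omega> * of_int (round (\<theta> / \<omega>))) * t + \<omega> * K * t"
        using nn by (simp add: algebra_simps)
      then show ?thesis
        by (simp only: Complex.DeMoivre cis_mult integral [OF that, symmetric] add.commute)
    qed
    then have "poly q (cis (\<omega> * t)) = (\<Sum>\<theta>\<in>{\<theta>\<in>\<Theta>. c \<theta> p \<noteq> 0}. c \<theta> p * (cis (\<omega> * K * t) * cis (\<theta> * t)))"
      by (simp add: q_def poly_sum poly_monom)
    also have "\<dots> = (\<Sum>\<theta>\<in>\<Theta>. c \<theta> p * (cis (\<omega> * K * t) * cis (\<theta> * t)))"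
      using c(1) by (intro sum.mono_neutral_left) auto
    finally show ?thesis
      by (simp add: c(5) sum_distrib_left mult_ac)
  qed
  have q0: "q \<noteq> 0"
    using q [of t\<^sub>0] assms(4) by auto
  have degq: "degree q \<le> 2 * K"
    unfolding q_def
  proof (rule degree_sum_le)
    show "finite {\<theta> \<in> \<Theta>. c \<theta> p \<noteq> 0}" using c(1) by simp
  next
    fix \<theta> assume "\<theta> \<in> {\<theta> \<in> \<Theta>. c \<theta> p \<noteq> 0}"
    then have "nat (round (\<theta> / \<omega>) + int K) \<le> 2 * K"
      using range [of \<theta>] by auto
    then show "degree (monom (c \<theta> p) (nat (round (\<theta> / \<omega>) + int K))) \<le> 2 * K"
      using degree_monom_le order_trans by blast
  qed
  have inj: "inj_on (\<lambda>t. cis (\<omega> * t)) {0..<P}"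
  proof (rule inj_onI)
    fix x y assume xy: "x \<in> {0..<P}" "y \<in> {0..<P}" "cis (\<omega> * x) = cis (\<omega> * y)"
    then obtain n :: int where "\<omega> * x = \<omega> * y + 2 * pi * n"
      unfolding cis_eq_iff by auto
    moreover have "\<omega> * P = 2 * pi"
      using P by (simp add: \<omega>_def)
    ultimately have "\<omega> * (x - y) = \<omega> * (P * n)"
      by (metis add_diff_cancel_left' mult.assoc right_diff_distrib)
    then have n: "x - y = P * n"
      using \<omega> by simp
    then have "\<bar>P * n\<bar> < P * 1"
      using xy by auto
    then have "\<bar>n\<bar> < 1"
      using P by (simp add: abs_mult)
    with n show "x = y"
      by simp
  qed
  let ?Z = "{t \<in> {0..<P}. g p t = 0}"
  have sub: "(\<lambda>t. cis (\<omega> * t)) ` ?Z \<subseteq> {z. poly q z = 0}"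
    by (auto simp: q)
  have inj': "inj_on (\<lambda>t. cis (\<omega> * t)) ?Z"
    using inj by (rule inj_on_subset) auto
  show fin: "finite ?Z"
    using sub poly_roots_finite [OF q0] inj' by (meson finite_imageD finite_subset)
  have "card ?Z \<le> card {z. poly q z = 0}"
    by (rule card_inj_on_le [OF inj' sub poly_roots_finite [OF q0]])
  also have "\<dots> \<le> 2 * K"
    using card_poly_roots_bound [OF q0] degq by linarith
  finally have "real (card ?Z) \<le> 2 * real K"
    by linarith
  also have "0 \<le> W"
    using c assms(4) by (cases "\<Theta> = {}") auto
  then have "real K \<le> W / \<omega>"
    using \<omega> by (simp add: K_def of_nat_floor)
  then have "2 * real K \<le> W * P / pi"
    by (simp add: \<omega>_def field_simps)
  finally show "real (card ?Z) \<le> W * P / pi" .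
qed

section \<open>Trigonometric polynomials\<close>

lemma trig_poly_periodic:
  assumes "trig_poly n p"
  shows "p (u + 2 * pi) = p u"
proof -
  have "cos (real m * (u + 2 * pi)) = cos (real m * u)"
       "sin (real m * (u + 2 * pi)) = sin (real m * u)" for m
    using cis_eq_iff [of "real m * (u + 2 * pi)" "real m * u"]
    by (auto simp: complex_eq_iff algebra_simps intro: exI [of _ "int m"])
  then show ?thesis
    using assms unfolding trig_poly_def by force
qed

lemma trig_poly_mono:
  assumes "trig_poly n p" "n \<le> m"
  shows "trig_poly m p"
proof -
  obtain a b where p: "\<And>u. p u = a 0 + (\<Sum>k=1..n. a k * cos (real k * u) + b k * sin (real k * u))"
    using assms(1) unfolding trig_poly_def by blast
  define a' where "a' = (\<lambda>k. if k \<le> n then a k else 0)"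
  define b' where "b' = (\<lambda>k. if k \<le> n then b k else 0)"
  have "p u = a' 0 + (\<Sum>k=1..m. a' k * cos (real k * u) + b' k * sin (real k * u))" for u
  proof -
    have "(\<Sum>k=1..n. a k * cos (real k * u) + b k * sin (real k * u))
        = (\<Sum>k=1..m. a' k * cos (real k * u) + b' k * sin (real k * u))"
      using assms(2) by (intro sum.mono_neutral_cong_left) (auto simp: a'_def b'_def)
    then show ?thesis
      by (simp add: p a'_def)
  qed
  then show ?thesis
    unfolding trig_poly_def by blast
qed

text \<open>Rescaling the parameter by \<open>1/c\<close> divides the weight of a trigonometric polynomial by \<open>c\<close>.\<close>

lemma exp_poly_trig_poly:
  assumes "trig_poly n p" "c > 0"
  shows "exp_poly (real n / real c) (\<lambda>q::'a::euclidean_space. \<lambda>t. complex_of_real (p ((t + \<tau>) / real c)))"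
proof -
  obtain a b where p: "\<And>u. p u = a 0 + (\<Sum>k=1..n. a k * cos (real k * u) + b k * sin (real k * u))"
    using assms(1) unfolding trig_poly_def by blast
  have cos_sin: "complex_of_real (x * cos \<phi> + y * sin \<phi>)
      = Complex (x / 2) (- y / 2) * cis \<phi> + Complex (x / 2) (y / 2) * cis (- \<phi>)" for x y \<phi>
    by (simp add: complex_eq_iff)
  let ?A = "\<lambda>k. Complex (a k / 2) (- b k / 2) * cis (real k / c * \<tau>)"
  let ?B = "\<lambda>k. Complex (a k / 2) (b k / 2) * cis (- (real k / c) * \<tau>)"
  have summand: "complex_of_real (a k * cos (real k * ((t + \<tau>) / c)) + b k * sin (real k * ((t + \<tau>) / c)))
      = ?A k * cis (real k / c * t) + ?B k * cis (- (real k / c) * t)" for k t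
    unfolding cos_sin mult.assoc cis_mult by (simp add: add_divide_distrib algebra_simps)
  have "exp_poly (real n / real c) (\<lambda>q::'a. \<lambda>t. complex_of_real (a 0) +
      (\<Sum>k=1..n. ?A k * cis (real k / c * t) + ?B k * cis (- (real k / c) * t)))"
    using assms(2)
    by (intro exp_poly_add exp_poly_sum exp_poly_const exp_poly_term [OF poly_map_degree_le_const [of 0]])
       (auto simp: divide_right_mono)
  then show ?thesis
    unfolding p of_real_add [of "a 0"] of_real_sum summand .
qed

section \<open>Strands and their start places\<close>

lemma inj_on_funpow_orbit:
  assumes "permutation f"
  shows "inj_on (\<lambda>j. (f ^^ j) x) {..<card (orbit f x)}"
proof -
  have x: "x \<in> orbit f x"
    using assms by (rule permutation_self_in_orbit)
  have "card (orbit f x) = funpow_dist1 f x x"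
    by (subst orbit_conv_funpow_dist1 [OF x])
       (simp only: card_image [OF inj_on_funpow_dist1 [OF x]] card_atLeastLessThan)
  then show ?thesis
    using inj_on_funpow_dist1 [OF x] by (simp add: lessThan_atLeast0)
qed

lemma word_pos_permutes:
  assumes "set w \<subseteq> letters s"
  shows "word_pos w k permutes {1..s}"
proof -
  have "fold letter_swap v permutes {1..s}" if "set v \<subseteq> letters s" for v
    using that
  proof (induction v)
    case (Cons a v)
    then have "letter_swap a permutes {1..s}"
      unfolding letter_swap_def by (intro permutes_swap_id) (auto simp: letters_def)
    moreover have "fold letter_swap v permutes {1..s}"
      using Cons by simp
    ultimately show ?case
      using permutes_compose by (simp only: fold_Cons)
  qed (simp add: permutes_id)
  then show ?thesis
    using assms set_take_subset [of k w] unfolding word_pos_def by blast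
qed

text \<open>The strand glued to the end of \<open>S\<close> in the closure.\<close>

definition next_strand :: "strand \<Rightarrow> strand" where
  "next_strand S = (fst S, Suc (snd S) mod card (fst S))"

lemma on_strand_add_2pi:
  assumes "trig_poly n (F (fst S))" "snd S < card (fst S)"
  shows "on_strand F S (t + 2 * pi) = on_strand F (next_strand S) t"
proof (cases "Suc (snd S) < card (fst S)")
  case True
  then show ?thesis
    by (simp add: on_strand_def strand_param_def next_strand_def algebra_simps)
next
  case False
  then have c: "card (fst S) = Suc (snd S)"
    using assms(2) by simp
  then have "strand_param S (t + 2 * pi) = strand_param (next_strand S) t + 2 * pi"
    by (simp add: strand_param_def next_strand_def field_simps)
  then show ?thesis
    using trig_poly_periodic [OF assms(1)] by (simp add: on_strand_def next_strand_def)
qed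

lemma interval_subset: "k < length w \<Longrightarrow> interval w k \<subseteq> {0..2 * pi}"
proof
  fix t assume k: "k < length w" and t: "t \<in> interval w k"
  have "0 \<le> 2 * pi * real k / real (length w)"
    by (rule divide_nonneg_nonneg) simp_all
  moreover have "2 * pi * real (k + 1) / real (length w) \<le> 2 * pi"
    using k by (simp add: divide_le_eq)
  ultimately show "t \<in> {0..2 * pi}"
    using t unfolding interval_def atLeastAtMost_iff by linarith
qed

lemma card_image_pairs_le:
  fixes c l :: nat
  shows "finite {f j k | j k. j < c \<and> k < l \<and> Q j k}"
    and "card {f j k | j k. j < c \<and> k < l \<and> Q j k} \<le> c * l"
proof -
  have sub: "{f j k | j k. j < c \<and> k < l \<and> Q j k} \<subseteq> (\<lambda>(j, k). f j k) ` ({..<c} \<times> {..<l})"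
    by auto
  show "finite {f j k | j k. j < c \<and> k < l \<and> Q j k}"
    by (rule finite_subset [OF sub]) simp
  have "card {f j k | j k. j < c \<and> k < l \<and> Q j k} \<le> card ((\<lambda>(j, k). f j k) ` ({..<c} \<times> {..<l}))"
    by (rule card_mono [OF _ sub]) simp
  also have "\<dots> \<le> card ({..<c} \<times> {..<l})"
    by (rule card_image_le) simp
  finally show "card {f j k | j k. j < c \<and> k < l \<and> Q j k} \<le> c * l"
    by simp
qed

text \<open>A braid word together with a choice \<open>b C\<close> of the place where the first strand of \<open>C\<close> starts.\<close>

locale closed_braid_word =
  fixes s :: nat and w :: "letter list" and b :: "nat set \<Rightarrow> nat"
  assumes letters: "set w \<subseteq> letters s"
    and base_in: "C \<in> closure_components s w \<Longrightarrow> b C \<in> C"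
begin

abbreviation "comps \<equiv> closure_components s w"

abbreviation closing :: "nat \<Rightarrow> nat" where
  "closing \<equiv> word_pos w (length w)"

lemma permutation_closing: "permutation closing"
  using word_pos_permutes [OF letters] permutation_permutes by blast

lemma component_eq_orbit:
  assumes "C \<in> comps"
  shows "C = orbit closing (b C)"
proof -
  obtain x where "C = orbit closing x"
    using assms unfolding closure_components_def by blast
  then show ?thesis
    using orbit_cyclic_eq3 [OF cyclic_on_orbit' [OF permutation_closing, of x]] base_in [OF assms]
    by metis
qed

lemma component_subset:
  assumes "C \<in> comps"
  shows "C \<subseteq> {1..s}"
  using assms permutes_orbit_subset [OF word_pos_permutes [OF letters]]
  unfolding closure_components_def by blast

lemma card_component_pos:
  assumes "C \<in> comps"
  shows "card C > 0"
  using base_in [OF assms] component_subset [OF assms]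
  by (metis card_gt_0_iff empty_iff finite_atLeastAtMost finite_subset)

lemma finite_components: "finite comps"
  unfolding closure_components_def by simp

lemma finite_strands: "finite (strands s w)"
  unfolding strands_def using finite_components by blast

lemma funpow_in_component: "C \<in> comps \<Longrightarrow> (closing ^^ j) (b C) \<in> C"
  using component_eq_orbit base_in funpow_in_orbit by metis

lemma strand_place_0: "strand_place w b 0 (C, j) = (closing ^^ j) (b C)"
  by (simp add: strand_place_def word_pos_def)

lemma strand_place_0_in: "S \<in> strands s w \<Longrightarrow> strand_place w b 0 S \<in> {1..s}"
  using funpow_in_component component_subset
  by (cases S) (auto simp: strands_def strand_place_0 subset_iff simp del: atLeastAtMost_iff)

text \<open>
  The start places of the strands of \<open>C\<close> run through the orbit \<open>C\<close> without repetition. So distinct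
  strands start apart, which makes their differences nonzero functions, and there are at most \<open>s\<close>
  of them.
\<close>

lemma inj_on_strand_place_0: "inj_on (strand_place w b 0) (strands s w)"
proof (rule inj_onI, clarify)
  fix C j C' j'
  assume S: "(C, j) \<in> strands s w" "(C', j') \<in> strands s w"
    and eq: "strand_place w b 0 (C, j) = strand_place w b 0 (C', j')"
  have C: "C \<in> comps" "C' \<in> comps" "j < card C" "j' < card C'"
    using S by (auto simp: strands_def)
  have orb: "orbit closing (strand_place w b 0 (D, i)) = D" if "D \<in> comps" for D i
  proof -
    have "cyclic_on closing D"
      using cyclic_on_orbit' [OF permutation_closing] component_eq_orbit [OF that] by metis
    then show ?thesis
      using orbit_cyclic_eq3 funpow_in_component [OF that] by (metis strand_place_0)
  qed
  then have CC: "C = C'"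
    using C eq by metis
  have "inj_on (\<lambda>j. (closing ^^ j) (b C)) {..<card C}"
    using inj_on_funpow_orbit [OF permutation_closing, of "b C"] component_eq_orbit [OF C(1)] by simp
  then have "j = j'"
    by (rule inj_onD) (use eq C CC in \<open>auto simp: strand_place_0\<close>)
  then show "C = C' \<and> j = j'"
    using CC by simp
qed

lemma card_strands_le: "card (strands s w) \<le> s"
  using card_inj_on_le [OF inj_on_strand_place_0 image_subsetI [OF strand_place_0_in]] by simp

lemma first_strand_in: "C \<in> comps \<Longrightarrow> (C, 0) \<in> strands s w"
  using card_component_pos by (auto simp: strands_def)

lemma next_strand_in: "S \<in> strands s w \<Longrightarrow> next_strand S \<in> strands s w"
  by (auto simp: strands_def next_strand_def intro!: mod_less_divisor)

lemma bij_betw_next_strand: "bij_betw next_strand (strands s w) (strands s w)"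
proof -
  have "inj_on next_strand (strands s w)"
  proof (rule inj_onI)
    fix S S' assume "S \<in> strands s w" "S' \<in> strands s w" "next_strand S = next_strand S'"
    then show "S = S'"
      by (cases S, cases S') (auto simp: strands_def next_strand_def mod_Suc split: if_splits)
  qed
  then show ?thesis
    using endo_inj_surj [OF finite_strands image_subsetI [OF next_strand_in]]
    by (simp add: bij_betw_def)
qed

section \<open>Counting crossings\<close>

text \<open>
  All parameters that the crossings of \<open>B'\<close> can contribute to the interpolation of \<open>G\<^sub>C\<close>.
\<close>

definition crossing_params :: "(nat set \<Rightarrow> real \<Rightarrow> real) \<Rightarrow> nat set \<Rightarrow> real set" where
  "crossing_params F C = {strand_param (C, j) t | j t. j < card C \<and> t \<in> {0..2 * pi} \<and>
     (\<exists>S'\<in>strands s w. S' \<noteq> (C, j) \<and> on_strand F (C, j) t = on_strand F S' t)}"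

lemma exp_poly_on_strand:
  assumes "trig_poly n (F (fst S))" "S \<in> strands s w"
  shows "exp_poly (real n / real (card (fst S)))
    (\<lambda>q::'a::euclidean_space. \<lambda>t. complex_of_real (on_strand F S t))"
  unfolding on_strand_def strand_param_def
  using assms by (intro exp_poly_trig_poly) (auto simp: strands_def)

text \<open>
  Let \<open>\<Phi>\<^sub>S\<close> be the product of the differences of the strand \<open>S\<close> with all other strands. Since
  \<open>\<Phi>\<^sub>S(t + 2\<pi>) = \<Phi>\<^sub>S\<^sub>'(t)\<close> for the strand \<open>S'\<close> that follows \<open>S\<close>, going \<open>s\<^sub>C\<close> times around collects the crossings of all strands
  of \<open>C\<close> as zeros of the single function \<open>\<Phi>\<^sub>(\<^sub>C\<^sub>,\<^sub>0\<^sub>)\<close>, which has period \<open>2\<pi>s\<^sub>C\<close> although its factors need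
  not. It is not identically zero because distinct strands start at distinct places, and counting
  the zeros of the product avoids sorting the pairs of strands by their common periods.
\<close>

lemma card_crossing_params_le:
  assumes F: "\<And>C. C \<in> comps \<Longrightarrow> trig_poly (n C) (F C)"
    and start: "inj_on (\<lambda>S. on_strand F S 0) (strands s w)"
    and C: "C \<in> comps"
  shows "finite (crossing_params F C)"
    and "real (card (crossing_params F C)) \<le> 2 * real (card C) *
      (\<Sum>S\<in>strands s w - {(C, 0)}. max (real (n C) / card C) (real (n (fst S)) / card (fst S)))"
      (is "_ \<le> _ * ?W")
proof -
  define c where "c = card C"
  have c: "c > 0"
    using card_component_pos [OF C] by (simp add: c_def)
  define \<Phi> where "\<Phi> = (\<lambda>S t. \<Prod>S'\<in>strands s w - {S}.
      complex_of_real (on_strand F S t) - complex_of_real (on_strand F S' t))"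
  have F': "trig_poly (n (fst S)) (F (fst S))" "snd S < card (fst S)" if "S \<in> strands s w" for S
    using that F by (auto simp: strands_def)
  have next\<Phi>: "\<Phi> S (t + 2 * pi) = \<Phi> (next_strand S) t" if S: "S \<in> strands s w" for S t
  proof -
    have bij: "bij_betw next_strand (strands s w - {S}) (strands s w - {next_strand S})"
      using bij_betw_DiffI [OF bij_betw_next_strand, of "{S}" "{next_strand S}"] S next_strand_in [OF S]
      by simp
    show ?thesis
      unfolding \<Phi>_def prod.reindex_bij_betw [OF bij, symmetric]
      using on_strand_add_2pi [where F = F, OF F'] S by (intro prod.cong) auto
  qed
  have shift\<Phi>: "\<Phi> (C, 0) (t + 2 * pi * real j) = \<Phi> (C, j mod c) t" for j t
  proof (induction j arbitrary: t)
    case (Suc j)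
    have "\<Phi> (C, 0) (t + 2 * pi * real (Suc j)) = \<Phi> (C, 0) ((t + 2 * pi) + 2 * pi * real j)"
      by (simp add: algebra_simps)
    also have "\<dots> = \<Phi> (C, j mod c) (t + 2 * pi)"
      by (rule Suc)
    also have "\<dots> = \<Phi> (next_strand (C, j mod c)) t"
      using C c by (intro next\<Phi>) (simp add: strands_def c_def)
    finally show ?case
      by (simp add: next_strand_def mod_Suc_eq c_def)
  qed simp
  define P where "P = 2 * pi * real c"
  have P: "P > 0"
    using c by (simp add: P_def)
  have periodic: "\<Phi> (C, 0) (t + P) = \<Phi> (C, 0) t" for t
    using shift\<Phi> [of t c] shift\<Phi> [of t 0] by (simp add: P_def)
  have non0: "\<Phi> (C, 0) 0 \<noteq> 0"
  proof -
    have "on_strand F (C, 0) 0 \<noteq> on_strand F S 0" if "S \<in> strands s w - {(C, 0)}" for S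
      using inj_onD [OF start] that first_strand_in [OF C] by blast
    then show ?thesis
      using finite_strands by (simp add: \<Phi>_def)
  qed
  have exp: "exp_poly ?W (\<lambda>q::real^3. \<Phi> (C, 0))"
    unfolding \<Phi>_def
  proof (rule exp_poly_prod)
    fix S assume S: "S \<in> strands s w - {(C, 0)}"
    show "exp_poly (max (real (n C) / card C) (real (n (fst S)) / card (fst S)))
       (\<lambda>q::real^3. \<lambda>t. complex_of_real (on_strand F (C, 0) t) - complex_of_real (on_strand F S t))"
      using exp_poly_on_strand [of "n C" F "(C, 0)"] exp_poly_on_strand [of "n (fst S)" F S]
        F'[of S] F [OF C] first_strand_in [OF C] S
      by (intro exp_poly_diff) (auto intro: exp_poly_mono)
  qed
  note zeros = card_zeros_exp_poly_le [OF exp P, OF periodic non0]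
  let ?Z = "{t \<in> {0..<P}. \<Phi> (C, 0) t = 0}"
  have sub: "(\<lambda>u. real c * u) ` crossing_params F C \<subseteq> ?Z"
  proof (rule image_subsetI)
    fix u assume "u \<in> crossing_params F C"
    then obtain j t S' where u_def: "u = strand_param (C, j) t"
      and j: "j < card C" and t: "0 \<le> t" "t \<le> 2 * pi" and S': "S' \<in> strands s w" "S' \<noteq> (C, j)"
      and eq: "on_strand F (C, j) t = on_strand F S' t"
      unfolding crossing_params_def by auto
    have u: "real c * u = t + 2 * pi * real j"
      using c by (simp add: u_def strand_param_def c_def)
    have "\<Phi> (C, j) t = 0"
      using finite_strands S' eq by (auto simp: \<Phi>_def)
    then have zero: "\<Phi> (C, 0) (t + 2 * pi * real j) = 0"
      using shift\<Phi> [of t j] j by (simp add: c_def)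
    \<comment> \<open>The end point \<open>P\<close> is excluded: by periodicity it would be a crossing at \<open>t = 0\<close>.\<close>
    have "t + 2 * pi * real j \<le> 2 * pi * real (Suc j)"
      using t by (simp add: algebra_simps)
    also have "\<dots> \<le> P"
      using j unfolding P_def c_def by (intro mult_left_mono) auto
    finally have "t + 2 * pi * real j \<le> P" .
    moreover have "t + 2 * pi * real j \<noteq> P"
      using zero non0 periodic [of 0] by auto
    ultimately show "real c * u \<in> ?Z"
      using u t zero by simp
  qed
  have inj: "inj_on (\<lambda>u. real c * u) (crossing_params F C)"
    using c by (simp add: inj_on_def)
  have fin: "finite ?Z"
    using zeros(1) .
  show "finite (crossing_params F C)"
    using finite_subset [OF sub fin] inj by (rule finite_imageD)
  have "real (card (crossing_params F C)) \<le> real (card ?Z)"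
    using card_inj_on_le [OF inj sub fin] by simp
  also have "\<dots> \<le> ?W * P / pi"
    using zeros(2) .
  finally show "real (card (crossing_params F C)) \<le> 2 * real (card C) * ?W"
    by (simp add: P_def c_def mult_ac)
qed

end

section \<open>Arithmetic of the degree bound\<close>

text \<open>
  The contribution of a component with \<open>c\<close> strands to half of the degree bound; the first argument of
  the maximum is \<open>\<lfloor>((c + 1)(c l - 1) + l c (s - c) - 1) / 2\<rfloor>\<close> multiplied out.
\<close>

definition half_degree :: "nat \<Rightarrow> nat \<Rightarrow> nat \<Rightarrow> int" where
  "half_degree s l c = max ((int c * int l * (int s + 1) - int c - 2) div 2) (int c)"

lemma half_degree_eq:
  "max \<lfloor>((real c + 1) * (real c * real l - 1) + real l * real c * (real s - real c) - 1) / 2\<rfloor> (int c)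
     = half_degree s l c"
proof -
  have "((real c + 1) * (real c * real l - 1) + real l * real c * (real s - real c) - 1) / 2
      = real_of_int (int c * int l * (int s + 1) - int c - 2) / real_of_int 2"
    by (simp add: algebra_simps)
  then show ?thesis
    unfolding half_degree_def by (simp only: floor_divide_of_int_eq)
qed

lemma half_degree_ge: "int c \<le> half_degree s l c"
  by (simp add: half_degree_def)

text \<open>
  Each of the \<open>c\<close> strands has at most one data point per letter in the steps for \<open>F\<close>, \<open>H\<close> and \<open>R\<close>.
  For \<open>l \<le> 2\<close> these are at most \<open>2c\<close>. For larger \<open>l\<close> the floor is large enough, because a word with
  a letter needs \<open>s \<ge> 2\<close>.
\<close>

lemma half_degree_ge_data:
  assumes "0 < c" and s: "0 < l \<Longrightarrow> 2 \<le> s"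
  shows "int (c * l) \<le> 2 * half_degree s l c"
proof (cases "l \<le> 2")
  case True
  then have "c * l \<le> 2 * c"
    by simp
  then show ?thesis
    using half_degree_ge [of c s l] by linarith
next
  case False
  define m where "m = int c * int l"
  have m: "3 * int c \<le> m"
    unfolding m_def using False by (subst mult.commute) (intro mult_left_mono, auto)
  have "m * 3 \<le> m * (int s + 1)"
    using s False m by (intro mult_left_mono) auto
  then have "m \<le> 2 * ((m * (int s + 1) - int c - 2) div 2)"
    using m assms(1) by linarith
  then show ?thesis
    unfolding half_degree_def m_def by simp
qed

text \<open>
  The floor is that of \<open>(c l (s + 1) - c - 2) / 2\<close>, whose numerator exceeds \<open>c l (s - 1)\<close> by
  \<open>c (2 l - 1) - 2\<close>. This is nonnegative except for \<open>c = l = 1\<close>, where one crossing fewer must be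
  available; when \<open>s \<le> 3\<close> the value \<open>c = 1\<close> of the maximum suffices.
\<close>

lemma half_degree_ge_crossings:
  assumes "0 < c" and "0 < l" and N: "N \<le> c * l * (s - 1)" "1 \<le> s"
    and special: "c = 1 \<Longrightarrow> l = 1 \<Longrightarrow> 4 \<le> s \<Longrightarrow> N \<le> s - 2"
  shows "int (N div 2) \<le> half_degree s l c"
proof (cases "c = 1 \<and> l = 1")
  case True
  have "int (N div 2) \<le> max ((int s - 2) div 2) 1"
  proof (cases "4 \<le> s")
    case True
    with special \<open>c = 1 \<and> l = 1\<close> show ?thesis by linarith
  next
    case False
    with N True show ?thesis by simp
  qed
  then show ?thesis
    using True by (simp add: half_degree_def)
next
  case False
  define m where "m = int c * int l"
  have "int N \<le> m * (int s - 1)"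
  proof -
    have "int N \<le> int (c * l * (s - 1))"
      using N(1) by (simp only: of_nat_le_iff)
    then show ?thesis
      using N(2) by (simp add: m_def of_nat_diff)
  qed
  moreover have "int c + 2 \<le> 2 * m"
  proof (cases "c = 1")
    case True
    then show ?thesis using False assms by (simp add: m_def)
  next
    case False
    have "int c * 1 \<le> m"
      unfolding m_def using assms by (intro mult_left_mono) auto
    then show ?thesis using False assms by linarith
  qed
  moreover have "m * (int s + 1) = m * (int s - 1) + 2 * m"
    by (simp add: algebra_simps)
  ultimately have "int N \<le> m * (int s + 1) - int c - 2"
    by linarith
  then show ?thesis
    unfolding half_degree_def m_def by linarith
qed

section \<open>Degrees of the interpolants and of the braid polynomial\<close>

context closed_braid_word
begin

lemma strands_ge_2: "w \<noteq> [] \<Longrightarrow> 2 \<le> s"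
  using letters by (cases w) (auto simp: letters_def)

lemma inj_on_start:
  assumes "step1 s w b X F" "w \<noteq> []"
  shows "inj_on (\<lambda>S. on_strand F S 0) (strands s w)"
proof -
  have "on_strand F S 0 = X (strand_place w b 0 S)" if S: "S \<in> strands s w" for S
  proof -
    obtain C j where Cj: "S = (C, j)" "C \<in> comps" "j < card C"
      using S by (auto simp: strands_def)
    have "(strand_param (C, j) 0, X (strand_place w b 0 (C, j))) \<in>
        {(strand_param (C, j) (2*pi * real k / real (length w)), X (strand_place w b k (C, j))) |
             j k. j < card C \<and> k < length w}"
      using Cj assms(2) by force
    then show ?thesis
      using assms(1) Cj unfolding step1_def trig_interpolates_def on_strand_def by fastforce
  qed
  moreover have "inj_on (\<lambda>S. X (strand_place w b 0 S)) (strands s w)"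
  proof -
    have "inj_on X {1..s}"
      using assms(1) unfolding step1_def by (auto intro: strict_mono_on_imp_inj_on)
    then have "inj_on (X \<circ> strand_place w b 0) (strands s w)"
      using strand_place_0_in
      by (intro comp_inj_on inj_on_strand_place_0) (auto intro: inj_on_subset)
    then show ?thesis
      by (simp add: o_def)
  qed
  ultimately show ?thesis
    by (simp cong: inj_on_cong)
qed

lemma trig_poly_step1:
  assumes "step1 s w b X F" "C \<in> comps"
  shows "trig_poly ((card C * length w) div 2) (F C)"
proof -
  let ?D = "{(strand_param (C, j) (2*pi * real k / real (length w)), X (strand_place w b k (C, j))) |
             j k. j < card C \<and> k < length w}"
  have "trig_poly (card ?D div 2) (F C)"
    using assms unfolding step1_def trig_interpolates_def by blast
  moreover have "card ?D \<le> card C * length w"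
    using card_image_pairs_le(2) [of _ "card C" "length w" "\<lambda>_ _. True"] by simp
  ultimately show ?thesis
    by (auto intro: trig_poly_mono div_le_mono)
qed

text \<open>
  A single letter moves only two places. So among four or more there is a fixed place besides the one
  of \<open>C\<close>, and a strand there has a constant \<open>x\<close>-coordinate, as \<open>C\<close> has: the two never cross.
\<close>

lemma ex_other_constant_strand:
  assumes "length w = 1" "C \<in> comps" "card C = 1" "4 \<le> s"
  shows "\<exists>S\<in>strands s w - {(C, 0)}. card (fst S) = 1"
proof -
  obtain a where w: "w = [a]"
    using assms(1) by (cases w) auto
  obtain x where C: "C = {x}"
    using assms(3) by (auto simp: card_1_singleton_iff)
  have "\<not> {1..s} \<subseteq> {x, idx a, Suc (idx a)}"
  proof
    assume "{1..s} \<subseteq> {x, idx a, Suc (idx a)}"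
    then have "card {1..s} \<le> card {x, idx a, Suc (idx a)}"
      by (intro card_mono) auto
    also have "\<dots> \<le> 3"
      by (simp add: card_insert_if)
    finally show False
      using assms(4) by simp
  qed
  then obtain y where y: "y \<in> {1..s}" "y \<noteq> x" "y \<noteq> idx a" "y \<noteq> Suc (idx a)"
    by blast
  have "closing y = y"
    using y by (simp add: w word_pos_def letter_swap_def Transposition.transpose_def)
  then have "orbit closing y = {y}"
    by (simp add: orbit_eq_singleton_iff)
  then have "{y} \<in> comps"
    using y(1) unfolding closure_components_def by (metis imageI)
  then show ?thesis
    using y(2) C by (intro bexI [of _ "({y}, 0)"]) (auto simp: strands_def)
qed

text \<open>
  For a word of length \<open>l\<close>, the difference of two strands has weight at most \<open>l/2\<close>. The other strands
  number at most \<open>s - 1\<close>, which gives at most \<open>s\<^sub>C l (s - 1)\<close> crossing parameters for \<open>C\<close>. When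
  \<open>s\<^sub>C = l = 1\<close> a constant difference has weight \<open>0\<close> and lowers the count to \<open>s - 2\<close>.
\<close>

lemma trig_degree_step2:
  assumes F: "step1 s w b X F" and G: "step2 s w b F G" and C: "C \<in> comps"
  obtains n where "trig_poly n (G C)" "int n \<le> half_degree s (length w) (card C)"
proof -
  define l where "l = length w"
  obtain y m where int: "trig_interpolates
          {(strand_param (C, j) t,
            if in_sigma_crossing s w b k (C, j) \<and> t = crossing_time s w b F k
            then m k else y (C, j) k) |
             j k t. j < card C \<and> k < length w \<and> t \<in> interval w k \<and>
               (\<exists>S'\<in>strands s w. S' \<noteq> (C, j) \<and> on_strand F (C, j) t = on_strand F S' t)}
          (G C)" (is "trig_interpolates ?D _")
    using G C unfolding step2_def by blast
  define D where "D = ?D"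
  have poly: "trig_poly (card D div 2) (G C)" and val: "\<And>u v. (u, v) \<in> D \<Longrightarrow> G C u = v"
    using int unfolding trig_interpolates_def D_def [symmetric] by auto
  have "int (card D div 2) \<le> half_degree s l (card C)"
  proof (cases "w = []")
    case True
    then have "D = {}"
      by (simp add: D_def)
    then show ?thesis
      using half_degree_ge [of "card C" s l] by simp
  next
    case False
    define n where "n = (\<lambda>C :: nat set. (card C * l) div 2)"
    let ?T = "crossing_params F C"
    let ?S = "strands s w - {(C, 0)}"
    let ?V = "\<lambda>S. max (real (n C) / card C) (real (n (fst S)) / card (fst S))"
    note T = card_crossing_params_le [of n F, OF _ inj_on_start [OF F False] C]
    have n: "trig_poly (n C) (F C)" if "C \<in> comps" for C
      using trig_poly_step1 [OF F that] by (simp add: n_def l_def)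
    \<comment> \<open>Consecutive intervals share an end, so the description of \<open>D\<close> does not show that it has only
      one value per parameter; that \<open>G C\<close> interpolates \<open>D\<close> does.\<close>
    have "fst ` D \<subseteq> ?T"
      using interval_subset [of _ w] unfolding crossing_params_def D_def by fastforce
    moreover have "inj_on fst D"
      using val by (intro inj_onI) (metis prod.collapse)
    ultimately have "card D \<le> card ?T"
      using T(1) n by (metis card_inj_on_le)
    then have bound: "real (card D) \<le> 2 * real (card C) * sum ?V ?S"
      using T(2) n by (meson of_nat_le_iff order_trans)
    have half: "real (n C) / card C \<le> l / 2" for C
    proof -
      have "2 * n C \<le> card C * l"
        by (simp add: n_def)
      then have "2 * real (n C) \<le> real (card C) * real l"
        by (metis of_nat_le_iff of_nat_mult of_nat_numeral)
      then show ?thesis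
        by (cases "card C = 0") (simp_all add: field_simps)
    qed
    have cardS: "card ?S \<le> s - 1"
      using card_strands_le first_strand_in [OF C] finite_strands by simp
    have s: "2 \<le> s"
      using False by (rule strands_ge_2)
    have "sum ?V ?S \<le> real (card ?S) * (l / 2)"
      by (intro sum_bounded_above max.boundedI half)
    also have "\<dots> \<le> real (s - 1) * (l / 2)"
      using cardS by (intro mult_right_mono) auto
    finally have "2 * real (card C) * sum ?V ?S \<le> 2 * real (card C) * (real (s - 1) * (l / 2))"
      by (rule mult_left_mono) simp
    with bound have "real (card D) \<le> real (card C * l * (s - 1))"
      by (simp add: mult_ac)
    then have general: "card D \<le> card C * l * (s - 1)"
      by (simp only: of_nat_le_iff)
    have special: "card D \<le> s - 2" if one: "card C = 1" "l = 1" "4 \<le> s"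
    proof -
      obtain S where S: "S \<in> ?S" "card (fst S) = 1"
        using ex_other_constant_strand C one unfolding l_def by blast
      have "sum ?V ?S = ?V S + sum ?V (?S - {S})"
        using S(1) finite_strands by (intro sum.remove) auto
      also have "?V S = 0"
        using S one by (simp add: n_def)
      also have "sum ?V (?S - {S}) \<le> real (card (?S - {S})) * (l / 2)"
        by (intro sum_bounded_above max.boundedI half)
      also have "\<dots> \<le> real (s - 2) * (l / 2)"
        using cardS S(1) finite_strands by (intro mult_right_mono) auto
      finally have "2 * real (card C) * sum ?V ?S \<le> real (s - 2)"
        using one by simp
      with bound show ?thesis
        by linarith
    qed
    show ?thesis
      using general special s False card_component_pos [OF C]
      by (intro half_degree_ge_crossings) (auto simp: l_def)
  qed
  with poly show thesis
    by (rule that [folded l_def])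
qed

lemma trig_degree_step3:
  assumes "step3 s w b F H" "C \<in> comps"
  shows "trig_poly (card C * length w) (H C)"
proof -
  obtain h d where int: "trig_hermite_interpolates
          {(strand_param (C, j) (crossing_time s w b F k), h k, real (card C) * d (C, j) k) |
             j k. j < card C \<and> k < length w \<and> in_sigma_crossing s w b k (C, j)} (H C)"
       (is "trig_hermite_interpolates ?D _")
    using assms unfolding step3_def by blast
  have "card ?D \<le> card C * length w"
    by (rule card_image_pairs_le)
  then show ?thesis
    using int unfolding trig_hermite_interpolates_def by (auto intro: trig_poly_mono)
qed

lemma trig_degree_step4:
  assumes "step4 s w b F G H R"
  obtains R\<^sub>0 \<kappa> \<mu> where "R = (\<lambda>C u. \<mu> * (R\<^sub>0 C u + \<kappa>))"
    "\<And>C. C \<in> comps \<Longrightarrow> trig_poly (card C * length w div 2) (R\<^sub>0 C)"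
proof -
  obtain r R\<^sub>0 \<kappa> \<mu> where int: "\<forall>C\<in>comps.
        trig_interpolates
          {(strand_param (C, j) (crossing_time s w b F k), r (C, j) k) |
             j k. j < card C \<and> k < length w \<and> in_sigma_crossing s w b k (C, j)} (R\<^sub>0 C)"
      and R: "R = (\<lambda>C u. \<mu> * (R\<^sub>0 C u + \<kappa>))"
    using assms unfolding step4_def by blast
  have "trig_poly (card C * length w div 2) (R\<^sub>0 C)" if C: "C \<in> comps" for C
  proof -
    let ?D = "{(strand_param (C, j) (crossing_time s w b F k), r (C, j) k) |
             j k. j < card C \<and> k < length w \<and> in_sigma_crossing s w b k (C, j)}"
    have "card ?D \<le> card C * length w"
      by (rule card_image_pairs_le)
    then show ?thesis
      using int C unfolding trig_interpolates_def by (blast intro: trig_poly_mono div_le_mono)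
  qed
  with R show thesis
    by (rule that)
qed

text \<open>
  With \<open>V = M\<^sub>C / s\<^sub>C\<close>, where \<open>M\<^sub>C\<close> is the half degree, the functions \<open>x - F\<close>, \<open>y - G\<close> and \<open>R\<close> have weight
  at most \<open>V\<close> on a strand of \<open>C\<close>; the coordinates need \<open>1 \<le> V\<close>, which is where \<open>s\<^sub>C\<close> enters the maximum.
  As \<open>z - H\<close> occurs unsquared, weight \<open>2V\<close> is allowed for it, matching the two conditions per data
  point of \<open>H\<close>. Each of the \<open>s\<^sub>C\<close> factors of \<open>C\<close> then has weight at most \<open>2V\<close>.
\<close>

lemma exp_poly_braid_poly:
  assumes F: "step1 s w b X F" and G: "step2 s w b F G" and H: "step3 s w b F H"
    and R: "step4 s w b F G H R"
  shows "exp_poly (\<Sum>C\<in>comps. 2 * real_of_int (half_degree s (length w) (card C)))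
    (braid_poly s w F G H R lam)"
proof -
  define M where "M = (\<lambda>C :: nat set. half_degree s (length w) (card C))"
  obtain R\<^sub>0 \<kappa> \<mu> where R_eq: "R = (\<lambda>C u. \<mu> * (R\<^sub>0 C u + \<kappa>))"
    and R\<^sub>0: "\<And>C. C \<in> comps \<Longrightarrow> trig_poly (card C * length w div 2) (R\<^sub>0 C)"
    using trig_degree_step4 [OF R] by blast
  have factor: "exp_poly (2 * real_of_int (M (fst S)) / card (fst S))
      (\<lambda>p t. circle_poly (strand_circle F G H R S t) ((1 / lam) *\<^sub>R p))"
    if S: "S \<in> strands s w" for S
  proof -
    define C where "C = fst S"
    have C: "C \<in> comps"
      using S by (auto simp: strands_def C_def)
    have c: "0 < card C"
      by (rule card_component_pos [OF C])
    define V where "V = real_of_int (M C) / card C"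
    have data: "int (card C * length w) \<le> 2 * M C"
      unfolding M_def using c strands_ge_2 by (intro half_degree_ge_data) auto
    have V1: "1 \<le> V"
      using c half_degree_ge [of "card C" s "length w"] by (simp add: V_def M_def le_divide_eq)
    have low: "exp_poly V (\<lambda>(p::real^3) t. complex_of_real (on_strand f S t))"
      if "trig_poly n (f C)" "int n \<le> M C" for f n
    proof (rule exp_poly_mono)
      show "exp_poly (real n / card (fst S)) (\<lambda>(p::real^3) t. complex_of_real (on_strand f S t))"
        using that(1) S by (intro exp_poly_on_strand) (simp_all add: C_def)
      show "real n / card (fst S) \<le> V"
        using that(2) unfolding V_def C_def [symmetric] by (intro divide_right_mono) auto
    qed
    have half: "int (card C * length w div 2) \<le> M C"
      using data by linarith
    have F': "exp_poly V (\<lambda>(p::real^3) t. complex_of_real (on_strand F S t))"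
      using trig_poly_step1 [OF F C] half by (rule low)
    have G': "exp_poly V (\<lambda>(p::real^3) t. complex_of_real (on_strand G S t))"
      using trig_degree_step2 [OF F G C] low unfolding M_def by metis
    have "exp_poly V (\<lambda>(p::real^3) t. complex_of_real (on_strand R\<^sub>0 S t))"
      using R\<^sub>0 [OF C] half by (rule low)
    then have "exp_poly (0 + V) (\<lambda>(p::real^3) t. of_real \<mu> * (complex_of_real (on_strand R\<^sub>0 S t) + of_real \<kappa>))"
      using V1 by (intro exp_poly_mult exp_poly_add exp_poly_const) auto
    then have R': "exp_poly V (\<lambda>(p::real^3) t. complex_of_real (on_strand R S t))"
      by (simp add: R_eq on_strand_def)
    have "exp_poly (real (card C * length w) / card (fst S))
        (\<lambda>(p::real^3) t. complex_of_real (on_strand H S t))"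
      using trig_degree_step3 [OF H C] S by (intro exp_poly_on_strand) (simp_all add: C_def)
    moreover have "real (card C * length w) / card (fst S) \<le> V + V"
    proof -
      have "real (card C * length w) \<le> 2 * real_of_int (M C)"
        using data by linarith
      then have "real (card C * length w) / card C \<le> 2 * real_of_int (M C) / card C"
        by (rule divide_right_mono) simp
      then show ?thesis
        by (simp add: V_def C_def)
    qed
    ultimately have H': "exp_poly (V + V) (\<lambda>(p::real^3) t. complex_of_real (on_strand H S t))"
      by (rule exp_poly_mono)
    define x where "x = (\<lambda>i (p::real^3). complex_of_real (((1 / lam) *\<^sub>R p) $ i))"
    have coord: "exp_poly W (\<lambda>p t. x i p)" if "1 \<le> W" for W i
      unfolding x_def using that
      by (intro exp_poly_linear linearI) (simp_all add: complex_eq_iff algebra_simps)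
    have square: "exp_poly (V + V) (\<lambda>p t. g p t * g p t)"
      if "exp_poly V g" for g :: "real^3 \<Rightarrow> real \<Rightarrow> complex"
      by (rule exp_poly_mult [OF that that])
    have "exp_poly (V + V) (\<lambda>p t.
        (x 1 p - of_real (on_strand F S t)) * (x 1 p - of_real (on_strand F S t)) +
        (x 2 p - of_real (on_strand G S t)) * (x 2 p - of_real (on_strand G S t)) -
        of_real (on_strand R S t) * of_real (on_strand R S t))"
      by (intro exp_poly_add [OF square square, THEN exp_poly_diff] exp_poly_diff square
          coord V1 F' G' R')
    moreover have "exp_poly (0 + (V + V)) (\<lambda>p t. \<i> * (x 3 p - of_real (on_strand H S t)))"
      using V1 by (intro exp_poly_diff exp_poly_mult exp_poly_const coord H') auto
    ultimately have "exp_poly (V + V) (\<lambda>p t.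
        (x 1 p - of_real (on_strand F S t)) * (x 1 p - of_real (on_strand F S t)) +
        (x 2 p - of_real (on_strand G S t)) * (x 2 p - of_real (on_strand G S t)) -
        of_real (on_strand R S t) * of_real (on_strand R S t) +
        \<i> * (x 3 p - of_real (on_strand H S t)))"
      unfolding add_0 by (rule exp_poly_add)
    then show ?thesis
      by (simp add: circle_poly_def strand_circle_def x_def V_def C_def power2_eq_square)
  qed
  have "(\<Sum>S\<in>strands s w. 2 * real_of_int (M (fst S)) / card (fst S))
      = (\<Sum>C\<in>comps. \<Sum>j<card C. 2 * real_of_int (M C) / card C)"
    unfolding strands_def by (subst sum.Sigma) (auto simp: finite_components split_def)
  also have "\<dots> = (\<Sum>C\<in>comps. 2 * real_of_int (M C))"
    using card_component_pos by (intro sum.cong) auto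
  finally have weight: "(\<Sum>S\<in>strands s w. 2 * real_of_int (M (fst S)) / card (fst S))
      = (\<Sum>C\<in>comps. 2 * real_of_int (M C))" .
  have "exp_poly (\<Sum>S\<in>strands s w. 2 * real_of_int (M (fst S)) / card (fst S))
      (\<lambda>p t. \<Prod>S\<in>strands s w. circle_poly (strand_circle F G H R S t) ((1 / lam) *\<^sub>R p))"
    by (intro exp_poly_prod factor)
  then show ?thesis
    unfolding weight unfolding braid_poly_def M_def .
qed

end

theorem proposition3p9:
  fixes s l :: nat and w :: "letter list" and B :: "motion set"
    and f :: "(real^3) \<times> complex \<Rightarrow> complex"
  assumes "B \<in> loop_braids s"
    and "set w \<subseteq> letters s" and "length w = l" and "word_motion w \<in> B"
    and "algorithm_output s B w f"
  shows "int (poly_map_degree f) \<le>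
    2 * (\<Sum>C\<in>closure_components s w.
           max \<lfloor>((real (card C) + 1) * (real (card C) * real l - 1)
                   + real l * real (card C) * (real s - real (card C)) - 1) / 2\<rfloor>
               (int (card C)))"
proof -
  obtain b X F G H R lam where
    b: "\<forall>C\<in>closure_components s w. b C \<in> C" and
    steps: "step1 s w b X F" "step2 s w b F G" "step3 s w b F H" "step4 s w b F G H R" and
    sub: "laurent_substitution (braid_poly s w F G H R lam) f"
    using assms(5) unfolding algorithm_output_def by blast
  interpret closed_braid_word s w b
    using assms(2) b by unfold_locales auto
  define D where "D = 2 * (\<Sum>C\<in>comps. half_degree s l (card C))"
  have "exp_poly (real_of_int D) (braid_poly s w F G H R lam)"
    using exp_poly_braid_poly [OF steps] by (simp add: D_def sum_distrib_left assms(3))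
  then have "poly_map_degree_le (nat \<lfloor>real_of_int D\<rfloor>) f"
    using sub by (rule poly_map_degree_le_laurent_substitution)
  then have "poly_map_degree f \<le> nat D"
    unfolding poly_map_degree_def by (simp add: Least_le)
  moreover have "0 \<le> half_degree s l c" for c
    using half_degree_ge [of c s l] by linarith
  then have "0 \<le> D"
    unfolding D_def by (simp add: sum_nonneg)
  ultimately have "int (poly_map_degree f) \<le> D"
    by linarith
  then show ?thesis
    by (simp only: half_degree_eq D_def)
qed

end
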